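(* Let $\mathcal H$ be a Hilbert space whose dimension $d$ is a prime number, with orthonormal basis $\{|k\rangle\}_{k=0}^{d-1}$, and let $\mathcal K$ be a finite-dimensional Hilbert space. For $0\le m,n\le d-1$ let $U_{m,n}=\sum_{k=0}^{d-1}e^{\frac{2\pi i}{d}kn}|k\oplus m\rangle\langle k|$, where $\oplus$ is addition modulo $d$. Let $p_n$ ($1\le n\le d-1$) and $r_m$ ($0\le m\le d-1$) be numbers in $[0,1]$ with $d\sum_{n=1}^{d-1}p_n+\sum_{m=0}^{d-1}r_m=1$, and let $$\Phi(\sigma)=\sum_{m=0}^{d-1}r_mU_{m,0}\sigma U_{m,0}^*+\sum_{m=0}^{d-1}\sum_{n=1}^{d-1}p_nU_{m,n}\sigma U_{m,n}^*,\qquad \sigma\in\mathfrak S(\mathcal H).$$ Suppose $\rho\in\mathfrak S(\mathcal H\otimes\mathcal K)$ is such that $\mathrm{Tr}_{\mathcal K}(\rho)$ belongs to the (maximal commutative) algebra generated by the projectors $|k\rangle\langle k|$, $0\le k\le d-1$, i.e. $\mathrm{Tr}_{\mathcal K}(\rho)$ is diagonal in the basis $\{|k\rangle\}$. Then for every quantum channel $\Omega:\mathfrak S(\mathcal K)\to\mathfrak S(\mathcal K)$, $$S((\Phi\otimes\Omega)(\rho))\ge H_\Phi(\mathrm{Tr}_{\mathcal K}(\rho))+H_\Omega(\mathrm{Tr}_{\mathcal H}(\rho)).$$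
   Context: $\mathfrak S(\cdot)$ denotes the set of density operators; a quantum channel is a completely positive trace-preserving linear map; $S(\sigma)=-\mathrm{Tr}(\sigma\log\sigma)$ is the von Neumann entropy. For a channel $\Psi$ with input space $\mathcal L$ and $\sigma\in\mathfrak S(\mathcal L)$, $H_\Psi(\sigma):=\min\sum_{j}\pi_jS(\Psi(\sigma_j))$, the minimum over all finite decompositions $\sigma=\sum_j\pi_j\sigma_j$ with $\{\pi_j\}$ a probability distribution and $\sigma_j\in\mathfrak S(\mathcal L)$. *)

theory Defs
  imports "Jordan_Normal_Form.Char_Poly"
begin

(* Operators on C^n are n x n complex matrices (Jordan_Normal_Form).
   The tensor product C^n1 (x) C^n2 is identified with C^(n1*n2) via
   |i> (x) |a>  <->  basis vector number i*n2 + a. *)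

definition ctrace :: "complex mat \<Rightarrow> complex" where
  "ctrace A = (\<Sum>i<dim_row A. A $$ (i, i))"

definition adj :: "complex mat \<Rightarrow> complex mat" where
  "adj A = mat (dim_col A) (dim_row A) (\<lambda>(i, j). cnj (A $$ (j, i)))"

definition msum :: "nat \<Rightarrow> ('b \<Rightarrow> complex mat) \<Rightarrow> 'b set \<Rightarrow> complex mat" where
  "msum n f I = mat n n (\<lambda>(i, j). \<Sum>x\<in>I. f x $$ (i, j))"

definition psd :: "nat \<Rightarrow> complex mat \<Rightarrow> bool" where
  "psd n A \<longleftrightarrow> A \<in> carrier_mat n n \<and>
     (\<forall>v \<in> carrier_vec n. Im (\<Sum>i<n. cnj (v $ i) * (A *\<^sub>v v) $ i) = 0 \<and>
                            Re (\<Sum>i<n. cnj (v $ i) * (A *\<^sub>v v) $ i) \<ge> 0)"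

definition density :: "nat \<Rightarrow> complex mat \<Rightarrow> bool" where
  "density n A \<longleftrightarrow> psd n A \<and> ctrace A = 1"

definition kron :: "complex mat \<Rightarrow> complex mat \<Rightarrow> complex mat" where
  "kron A B = mat (dim_row A * dim_row B) (dim_col A * dim_col B)
     (\<lambda>(i, j). A $$ (i div dim_row B, j div dim_col B) * B $$ (i mod dim_row B, j mod dim_col B))"

definition munit :: "nat \<Rightarrow> nat \<Rightarrow> nat \<Rightarrow> complex mat" where
  "munit n i j = mat n n (\<lambda>(a, b). if a = i \<and> b = j then 1 else 0)"

(* tensor product (A (x) B) of linear maps A on n1 x n1 and B on n2 x n2 matrices,
   defined on the basis |i><j| (x) |a><b| and extended linearly *)
definition tensor_map :: "nat \<Rightarrow> nat \<Rightarrow> (complex mat \<Rightarrow> complex mat) \<Rightarrow> (complex mat \<Rightarrow> complex mat)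
     \<Rightarrow> complex mat \<Rightarrow> complex mat" where
  "tensor_map n1 n2 A B X = msum (n1 * n2)
     (\<lambda>(i, j, a, b). X $$ (i * n2 + a, j * n2 + b) \<cdot>\<^sub>m kron (A (munit n1 i j)) (B (munit n2 a b)))
     ({..<n1} \<times> {..<n1} \<times> {..<n2} \<times> {..<n2})"

definition linear_map_on :: "nat \<Rightarrow> (complex mat \<Rightarrow> complex mat) \<Rightarrow> bool" where
  "linear_map_on n T \<longleftrightarrow>
     (\<forall>A \<in> carrier_mat n n. T A \<in> carrier_mat n n) \<and>
     (\<forall>A \<in> carrier_mat n n. \<forall>B \<in> carrier_mat n n. T (A + B) = T A + T B) \<and>
     (\<forall>A \<in> carrier_mat n n. \<forall>c. T (c \<cdot>\<^sub>m A) = c \<cdot>\<^sub>m T A)"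

definition completely_positive :: "nat \<Rightarrow> (complex mat \<Rightarrow> complex mat) \<Rightarrow> bool" where
  "completely_positive n T \<longleftrightarrow>
     (\<forall>k > 0. \<forall>X. psd (k * n) X \<longrightarrow> psd (k * n) (tensor_map k n (\<lambda>Y. Y) T X))"

definition trace_preserving :: "nat \<Rightarrow> (complex mat \<Rightarrow> complex mat) \<Rightarrow> bool" where
  "trace_preserving n T \<longleftrightarrow> (\<forall>A \<in> carrier_mat n n. ctrace (T A) = ctrace A)"

definition quantum_channel :: "nat \<Rightarrow> (complex mat \<Rightarrow> complex mat) \<Rightarrow> bool" where
  "quantum_channel n T \<longleftrightarrow> linear_map_on n T \<and> completely_positive n T \<and> trace_preserving n T"

definition eta :: "real \<Rightarrow> real" where
  "eta x = (if x \<le> 0 then 0 else x * ln x)"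

definition vn_entropy :: "complex mat \<Rightarrow> real" where
  "vn_entropy A = - (\<Sum>z\<in>{z. poly (char_poly A) z = 0}.
                        real (order z (char_poly A)) * eta (Re z))"

definition H_chan :: "nat \<Rightarrow> (complex mat \<Rightarrow> complex mat) \<Rightarrow> complex mat \<Rightarrow> real" where
  "H_chan n T \<sigma> = Inf {(\<Sum>j<N. \<pi> j * vn_entropy (T (s j))) | (N::nat) \<pi> s.
       (\<forall>j<N. \<pi> j \<ge> 0 \<and> density n (s j)) \<and> (\<Sum>j<N. \<pi> j) = 1 \<and>
       \<sigma> = msum n (\<lambda>j. complex_of_real (\<pi> j) \<cdot>\<^sub>m s j) {..<N}}"

definition ptrace_K :: "nat \<Rightarrow> nat \<Rightarrow> complex mat \<Rightarrow> complex mat" where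
  "ptrace_K dH dK \<rho> = mat dH dH (\<lambda>(i, j). \<Sum>a<dK. \<rho> $$ (i * dK + a, j * dK + a))"

definition ptrace_H :: "nat \<Rightarrow> nat \<Rightarrow> complex mat \<Rightarrow> complex mat" where
  "ptrace_H dH dK \<rho> = mat dK dK (\<lambda>(a, b). \<Sum>i<dH. \<rho> $$ (i * dK + a, i * dK + b))"

definition weyl :: "nat \<Rightarrow> nat \<Rightarrow> nat \<Rightarrow> complex mat" where
  "weyl d m n = mat d d (\<lambda>(r, k). if r = (k + m) mod d
       then exp (2 * of_real pi * \<i> * of_nat k * of_nat n / of_nat d) else 0)"

definition Phi :: "nat \<Rightarrow> (nat \<Rightarrow> real) \<Rightarrow> (nat \<Rightarrow> real) \<Rightarrow> complex mat \<Rightarrow> complex mat" where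
  "Phi d r p \<sigma> =
     msum d (\<lambda>m. complex_of_real (r m) \<cdot>\<^sub>m (weyl d m 0 * \<sigma> * adj (weyl d m 0))) {..<d} +
     msum d (\<lambda>(m, n). complex_of_real (p n) \<cdot>\<^sub>m (weyl d m n * \<sigma> * adj (weyl d m n)))
        ({..<d} \<times> {1..<d})"

end

theory Submission
  imports Defs "Jordan_Normal_Form.Schur_Decomposition" "HOL-Real_Asymp.Real_Asymp"
begin

text \<open>Write \<open>X\<close> for the cyclic shift and \<open>\<rho>' = (id \<otimes> \<Omega>)(\<rho>)\<close>. Averaged over all shifts, the Weyl
  conjugations pinch to the Fourier basis of the first factor, so \<open>(\<Phi> \<otimes> \<Omega>)(\<rho>) = \<Sum>\<^sub>m r\<^sub>m M\<^sub>m + Y\<close>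
  where \<open>M\<^sub>m = X\<^sup>m \<rho>' X\<^sup>-\<^sup>m\<close> and both \<open>Y\<close> and \<open>\<Sum>\<^sub>m M\<^sub>m\<close> are block diagonal in that basis. The
  heart of the proof is \<open>S (\<Sum>\<^sub>m r\<^sub>m M\<^sub>m + Y) \<ge> (1/d) \<Sum>\<^sub>m S (r\<^sub>m \<Sum>\<^sub>l M\<^sub>l + Y)\<close>. Truncate the
  weights at a level \<open>t\<close>: both sides agree at \<open>t = 0\<close>. As \<open>t\<close> grows, the derivatives are
  compared by operator monotonicity of the logarithm, since \<open>\<Sum>\<^sub>m min r\<^sub>m t M\<^sub>m\<close> is dominated by
  \<open>t \<Sum>\<^sub>m M\<^sub>m\<close> and \<open>Tr M\<^sub>m ln (t \<Sum>\<^sub>l M\<^sub>l + Y)\<close> does not depend on \<open>m\<close>; Klein's inequality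
  replaces the derivatives by finite steps. The right-hand side involves only the blocks
  \<open>r\<^sub>m \<omega>\<^sub>j + \<Sum>\<^sub>n p\<^sub>n \<omega>\<^sub>j\<^sub>-\<^sub>n\<close>, where \<open>\<omega>\<^sub>j = \<Omega>(\<rho>\<^sub>j)\<close> and \<open>\<rho>\<^sub>j = d \<langle>f\<^sub>j|\<rho>|f\<^sub>j\<rangle>\<close> for the Fourier vectors
  \<open>f\<^sub>j\<close>. The \<open>\<rho>\<^sub>j\<close> have trace one because \<open>Tr\<^sub>K \<rho>\<close> is diagonal, and concavity bounds the right-hand
  side below by \<open>- \<Sum>\<^sub>m \<lambda>\<^sub>m ln \<lambda>\<^sub>m + (1/d) \<Sum>\<^sub>j S(\<Omega>(\<rho>\<^sub>j))\<close> with \<open>\<lambda>\<^sub>m = r\<^sub>m + \<Sum>\<^sub>n p\<^sub>n\<close>. The first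
  term is \<open>S(\<Phi>(|k\<rangle>\<langle>k|))\<close> for every \<open>k\<close>, hence bounds \<open>H\<^sub>\<Phi>\<close> at diagonal states; and the average
  of the \<open>\<rho>\<^sub>j\<close> is \<open>Tr\<^sub>H \<rho>\<close>, so the second bounds \<open>H\<^sub>\<Omega>\<close>.\<close>

section \<open>Sesquilinear forms of kernels\<close>

text \<open>An operator on \<open>\<complex>\<^sup>n\<close> is handled as a kernel \<open>nat \<Rightarrow> nat \<Rightarrow> complex\<close> and a vector as a
  function, of which only the entries below \<open>n\<close> matter; sums and scalar multiples then need no
  carrier conditions.\<close>

type_synonym cvec = "nat \<Rightarrow> complex"

type_synonym kernel = "nat \<Rightarrow> nat \<Rightarrow> complex"

abbreviation cmod2 :: "complex \<Rightarrow> real" where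
  "cmod2 z \<equiv> (cmod z)\<^sup>2"

abbreviation (input) entry :: "complex mat \<Rightarrow> kernel" where
  "entry A \<equiv> \<lambda>x y. A $$ (x, y)"

definition cinner :: "nat \<Rightarrow> cvec \<Rightarrow> cvec \<Rightarrow> complex" where
  "cinner n f g = (\<Sum>x<n. cnj (f x) * g x)"

definition kernel_app :: "nat \<Rightarrow> kernel \<Rightarrow> cvec \<Rightarrow> cvec" where
  "kernel_app n M f x = (\<Sum>y<n. M x y * f y)"

definition sesq :: "nat \<Rightarrow> kernel \<Rightarrow> cvec \<Rightarrow> cvec \<Rightarrow> complex" where
  "sesq n M f g = cinner n f (kernel_app n M g)"

definition ktrace :: "nat \<Rightarrow> kernel \<Rightarrow> complex" where
  "ktrace n M = (\<Sum>x<n. M x x)"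

definition pos_kernel :: "nat \<Rightarrow> kernel \<Rightarrow> bool" where
  "pos_kernel n M \<longleftrightarrow> (\<forall>f. 0 \<le> sesq n M f f)"

definition kdelta :: kernel where
  "kdelta x y = (if x = y then 1 else 0)"

lemma cnj_kdelta [simp]: "cnj (kdelta x y) = kdelta x y"
  by (simp add: kdelta_def)

lemma sum_rotate3:
  "(\<Sum>x\<in>A. \<Sum>y\<in>B. \<Sum>z\<in>C. F x y z) = (\<Sum>y\<in>B. \<Sum>z\<in>C. \<Sum>x\<in>A. F x y z)"
  by (subst sum.swap) (intro sum.cong refl sum.swap)

lemma cnj_cinner: "cnj (cinner n f g) = cinner n g f"
  by (simp add: cinner_def mult.commute)

lemma cmod_cinner_commute: "cmod (cinner n f g) = cmod (cinner n g f)"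
  unfolding cnj_cinner[symmetric, of n g f] by simp

lemma cinner_self: "cinner n f f = of_real (\<Sum>x<n. cmod2 (f x))"
  unfolding cinner_def of_real_sum complex_norm_square by (simp add: mult.commute)

lemma sum_cmod2_pos:
  fixes n :: nat
  assumes "\<exists>x<n. f x \<noteq> 0"
  shows "0 < (\<Sum>x<n. cmod2 (f x))"
proof -
  obtain x where "x < n" "f x \<noteq> 0" using assms by blast
  then show ?thesis by (intro sum_pos2[of _ x]) auto
qed

lemma cinner_add_right: "cinner n f (\<lambda>x. g x + h x) = cinner n f g + cinner n f h"
  by (simp add: cinner_def ring_distribs sum.distrib)

lemma cinner_scale_right: "cinner n f (\<lambda>x. c * g x) = c * cinner n f g"
  by (simp add: cinner_def sum_distrib_left mult_ac)

lemma cinner_sum_right: "cinner n f (\<lambda>x. \<Sum>i\<in>I. c i * h i x) = (\<Sum>i\<in>I. c i * cinner n f (h i))"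
  unfolding cinner_def sum_distrib_left by (subst sum.swap) (simp add: mult_ac)

lemma cinner_cong:
  "(\<And>x. x < n \<Longrightarrow> f x = f' x) \<Longrightarrow> (\<And>x. x < n \<Longrightarrow> g x = g' x) \<Longrightarrow> cinner n f g = cinner n f' g'"
  by (simp add: cinner_def)

lemma sesq_eq: "sesq n M f g = (\<Sum>x<n. \<Sum>y<n. cnj (f x) * M x y * g y)"
  by (simp add: sesq_def cinner_def kernel_app_def sum_distrib_left mult.assoc)

lemma sesq_cong:
  assumes "\<And>x y. x < n \<Longrightarrow> y < n \<Longrightarrow> M x y = M' x y"
    and "\<And>x. x < n \<Longrightarrow> f x = f' x" "\<And>x. x < n \<Longrightarrow> g x = g' x"
  shows "sesq n M f g = sesq n M' f' g'"
  unfolding sesq_eq by (intro sum.cong refl) (simp add: assms)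

lemma sesq_add: "sesq n (\<lambda>x y. M x y + M' x y) f g = sesq n M f g + sesq n M' f g"
  by (simp add: sesq_eq ring_distribs sum.distrib)

lemma sesq_scale: "sesq n (\<lambda>x y. c * M x y) f g = c * sesq n M f g"
  by (simp add: sesq_eq sum_distrib_left mult_ac)

lemma sesq_sum: "sesq n (\<lambda>x y. \<Sum>i\<in>I. M i x y) f g = (\<Sum>i\<in>I. sesq n (M i) f g)"
  unfolding sesq_eq sum_distrib_left sum_distrib_right by (rule sum_rotate3[symmetric])

lemma sesq_kdelta_kdelta:
  assumes "i < n" "j < n"
  shows "sesq n M (kdelta i) (kdelta j) = M i j"
proof -
  have "sesq n M (kdelta i) (kdelta j)
      = (\<Sum>x<n. \<Sum>y<n. if y = j then (if x = i then M i j else 0) else 0)"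
    unfolding sesq_eq by (intro sum.cong refl) (auto simp: kdelta_def)
  then show ?thesis using assms by simp
qed

lemma sesq_kdelta: "sesq n kdelta f g = cinner n f g"
  unfolding sesq_eq cinner_def kdelta_def
  by (intro sum.cong refl)
    (simp add: if_distrib[of "\<lambda>c. _ * c"] if_distrib[of "\<lambda>c. c * _"] cong: if_cong)

lemma sesq_rank_one: "sesq n (\<lambda>x y. u x * cnj (u y)) f g = cinner n f u * cinner n u g"
  unfolding sesq_eq cinner_def sum_product by (simp add: mult_ac)

lemma sesq_add_scaled:
  "sesq n M (\<lambda>x. f x + c * g x) (\<lambda>x. f x + c * g x)
    = sesq n M f f + c * sesq n M f g + cnj c * sesq n M g f + cnj c * c * sesq n M g g"
  by (simp add: sesq_eq sum_distrib_left sum.distrib algebra_simps)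

lemma sesq_sum_vectors:
  "sesq n M (\<lambda>x. \<Sum>i\<in>I. c i * h i x) (\<lambda>x. \<Sum>j\<in>J. c' j * h' j x)
    = (\<Sum>i\<in>I. \<Sum>j\<in>J. cnj (c i) * c' j * sesq n M (h i) (h' j))"
proof -
  have right: "sesq n M f (\<lambda>x. \<Sum>j\<in>J. c' j * h' j x) = (\<Sum>j\<in>J. c' j * sesq n M f (h' j))" for f
  proof -
    have "kernel_app n M (\<lambda>x. \<Sum>j\<in>J. c' j * h' j x) = (\<lambda>x. \<Sum>j\<in>J. c' j * kernel_app n M (h' j) x)"
      unfolding kernel_app_def sum_distrib_left by (rule ext, subst sum.swap) (simp add: mult_ac)
    then show ?thesis by (simp add: sesq_def cinner_sum_right)
  qed
  have left: "sesq n M (\<lambda>x. \<Sum>i\<in>I. c i * h i x) g = (\<Sum>i\<in>I. cnj (c i) * sesq n M (h i) g)" for g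
  proof -
    have "sesq n M (\<lambda>x. \<Sum>i\<in>I. c i * h i x) g
        = cnj (cinner n (kernel_app n M g) (\<lambda>x. \<Sum>i\<in>I. c i * h i x))"
      by (simp add: sesq_def cnj_cinner)
    then show ?thesis by (simp add: cinner_sum_right cnj_cinner sesq_def)
  qed
  show ?thesis
    unfolding left right sum_distrib_left by (simp only: mult.assoc)
qed

lemma ktrace_sum: "ktrace n (\<lambda>x y. \<Sum>m\<in>I. c m * M m x y) = (\<Sum>m\<in>I. c m * ktrace n (M m))"
  unfolding ktrace_def sum_distrib_left by (rule sum.swap)

lemma pos_kernelD: "pos_kernel n M \<Longrightarrow> 0 \<le> sesq n M f f"
  by (simp add: pos_kernel_def)

lemma pos_kernel_cong:
  assumes "\<And>x y. x < n \<Longrightarrow> y < n \<Longrightarrow> M x y = M' x y"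
  shows "pos_kernel n M \<longleftrightarrow> pos_kernel n M'"
proof -
  have "sesq n M f f = sesq n M' f f" for f by (rule sesq_cong[OF assms refl refl])
  then show ?thesis by (simp add: pos_kernel_def)
qed

lemma Re_sesq_nonneg: "pos_kernel n M \<Longrightarrow> 0 \<le> Re (sesq n M f f)"
  using pos_kernelD[of n M f] by (simp add: less_eq_complex_def)

lemma pos_kernel_diag: "pos_kernel n M \<Longrightarrow> x < n \<Longrightarrow> 0 \<le> M x x"
  using pos_kernelD[of n M "kdelta x"] by (simp add: sesq_kdelta_kdelta)

lemma pos_kernel_add:
  "pos_kernel n M \<Longrightarrow> pos_kernel n M' \<Longrightarrow> pos_kernel n (\<lambda>x y. M x y + M' x y)"
  by (simp add: pos_kernel_def sesq_add)

lemma pos_kernel_scale: "pos_kernel n M \<Longrightarrow> 0 \<le> c \<Longrightarrow> pos_kernel n (\<lambda>x y. of_real c * M x y)"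
  by (simp add: pos_kernel_def sesq_scale less_eq_complex_def)

lemma pos_kernel_sum:
  "(\<And>i. i \<in> I \<Longrightarrow> pos_kernel n (M i)) \<Longrightarrow> pos_kernel n (\<lambda>x y. \<Sum>i\<in>I. M i x y)"
  by (simp add: pos_kernel_def sesq_sum sum_nonneg)

lemma pos_kernel_kdelta: "pos_kernel n kdelta"
  unfolding pos_kernel_def sesq_kdelta cinner_self by (simp add: less_eq_complex_def sum_nonneg)

lemma pos_kernel_hermitian:
  assumes "pos_kernel n M"
  shows "sesq n M g f = cnj (sesq n M f g)"
proof -
  have Im_sesq_self: "Im (sesq n M h h) = 0" for h
    using pos_kernelD[OF assms, of h] by (simp add: less_eq_complex_def)
  have "Im (c * sesq n M f g + cnj c * sesq n M g f) = 0" if "cmod c = 1" for c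
  proof -
    have "cnj c * c = 1" using that complex_norm_square[of c] by (simp add: mult.commute)
    then show ?thesis
      using Im_sesq_self[of "\<lambda>x. f x + c * g x"] Im_sesq_self[of f] Im_sesq_self[of g]
      by (simp add: sesq_add_scaled)
  qed
  from this[of 1] this[of \<i>] show ?thesis by (simp add: complex_eq_iff)
qed

lemma psd_iff_pos_kernel: "psd n A \<longleftrightarrow> A \<in> carrier_mat n n \<and> pos_kernel n (entry A)"
proof (cases "A \<in> carrier_mat n n")
  case carrier: True
  have form: "(\<Sum>i<n. cnj (v $ i) * (A *\<^sub>v v) $ i) = sesq n (entry A) (($) v) (($) v)"
    if "v \<in> carrier_vec n" for v
    using carrier that
    by (simp add: sesq_def cinner_def kernel_app_def scalar_prod_def atLeast0LessThan)
  have "psd n A \<longleftrightarrow> (\<forall>v\<in>carrier_vec n. 0 \<le> sesq n (entry A) (($) v) (($) v))"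
    unfolding psd_def less_eq_complex_def using carrier by (auto simp only: form zero_complex.simps)
  also have "\<dots> \<longleftrightarrow> pos_kernel n (entry A)"
  proof
    assume nonneg: "\<forall>v\<in>carrier_vec n. 0 \<le> sesq n (entry A) (($) v) (($) v)"
    have "sesq n (entry A) (($) (vec n f)) (($) (vec n f)) = sesq n (entry A) f f" for f
      by (intro sesq_cong) auto
    then show "pos_kernel n (entry A)"
      using bspec[OF nonneg vec_carrier] by (simp add: pos_kernel_def)
  qed (simp add: pos_kernel_def)
  finally show ?thesis using carrier by simp
qed (simp add: psd_def)

lemma density_iff:
  "density n A \<longleftrightarrow> A \<in> carrier_mat n n \<and> pos_kernel n (entry A) \<and> ktrace n (entry A) = 1"
  by (auto simp: density_def psd_iff_pos_kernel ctrace_def ktrace_def)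

section \<open>Spectral theorem\<close>

definition orthonormal :: "nat \<Rightarrow> nat \<Rightarrow> (nat \<Rightarrow> cvec) \<Rightarrow> bool" where
  "orthonormal n k e \<longleftrightarrow> (\<forall>i<k. \<forall>j<k. cinner n (e i) (e j) = kdelta i j)"

definition eigenbasis :: "nat \<Rightarrow> kernel \<Rightarrow> (nat \<Rightarrow> cvec) \<Rightarrow> (nat \<Rightarrow> real) \<Rightarrow> bool" where
  "eigenbasis n M e a \<longleftrightarrow> orthonormal n n e \<and>
    (\<forall>x<n. \<forall>y<n. M x y = (\<Sum>i<n. of_real (a i) * (e i x * cnj (e i y))))"

lemma orthonormalD: "orthonormal n k e \<Longrightarrow> i < k \<Longrightarrow> j < k \<Longrightarrow> cinner n (e i) (e j) = kdelta i j"
  by (simp add: orthonormal_def)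

lemma orthonormal_norm: "orthonormal n k e \<Longrightarrow> i < k \<Longrightarrow> (\<Sum>x<n. cmod2 (e i x)) = 1"
  using cinner_self[of n "e i"] orthonormalD[of n k e i i]
  by (simp add: kdelta_def flip: of_real_power of_real_sum)

lemma orthonormal_kdelta: "orthonormal n n kdelta"
  unfolding orthonormal_def
proof (intro allI impI)
  fix i j assume "i < n" "j < n"
  have "cinner n (kdelta i) (kdelta j) = (\<Sum>x<n. if x = i then kdelta j i else 0)"
    unfolding cinner_def by (intro sum.cong refl) (auto simp: kdelta_def)
  then show "cinner n (kdelta i) (kdelta j) = kdelta i j" using \<open>i < n\<close> by (simp add: kdelta_def)
qed

lemma orthonormal_mat_inverse:
  assumes "orthonormal n n e"
  shows "mat n n (\<lambda>(i, x). cnj (e i x)) * mat n n (\<lambda>(x, i). e i x) = 1\<^sub>m n" (is "?F * ?E = _")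
    and "mat n n (\<lambda>(x, i). e i x) * mat n n (\<lambda>(i, x). cnj (e i x)) = 1\<^sub>m n"
proof -
  show left: "?F * ?E = 1\<^sub>m n"
    using assms by (intro eq_matI)
      (auto simp: scalar_prod_def atLeast0LessThan orthonormal_def cinner_def kdelta_def)
  show "?E * ?F = 1\<^sub>m n" by (rule mat_mult_left_right_inverse[OF _ _ left]) auto
qed

lemma orthonormal_complete:
  assumes "orthonormal n n e" "x < n" "y < n"
  shows "(\<Sum>i<n. e i x * cnj (e i y)) = kdelta x y"
  using arg_cong[OF orthonormal_mat_inverse(2)[OF assms(1)], of "\<lambda>A. A $$ (x, y)"] assms
  by (simp add: scalar_prod_def atLeast0LessThan kdelta_def)

lemma parseval:
  assumes "orthonormal n n e"
  shows "cinner n f g = (\<Sum>i<n. cinner n f (e i) * cinner n (e i) g)"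
proof -
  have "cinner n f g = sesq n (\<lambda>x y. \<Sum>i<n. e i x * cnj (e i y)) f g"
    unfolding sesq_kdelta[symmetric]
    by (rule sesq_cong) (simp_all add: orthonormal_complete[OF assms])
  then show ?thesis by (simp add: sesq_sum sesq_rank_one)
qed

lemma parseval_norm:
  assumes "orthonormal n n e"
  shows "(\<Sum>i<n. cmod2 (cinner n (e i) f)) = (\<Sum>x<n. cmod2 (f x))"
proof -
  have "complex_of_real (\<Sum>x<n. cmod2 (f x)) = (\<Sum>i<n. cinner n f (e i) * cinner n (e i) f)"
    unfolding cinner_self[symmetric] by (rule parseval[OF assms])
  also have "\<dots> = complex_of_real (\<Sum>i<n. cmod2 (cinner n (e i) f))"
    unfolding of_real_sum complex_norm_square by (simp add: cnj_cinner mult.commute)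
  finally show ?thesis by (simp only: of_real_eq_iff)
qed

lemma ktrace_orthonormal:
  assumes "orthonormal n n e"
  shows "(\<Sum>i<n. sesq n M (e i) (e i)) = ktrace n M"
proof -
  have "(\<Sum>i<n. sesq n M (e i) (e i)) = (\<Sum>x<n. \<Sum>y<n. \<Sum>i<n. M x y * (e i y * cnj (e i x)))"
    unfolding sesq_eq by (subst sum_rotate3) (simp add: mult_ac)
  also have "\<dots> = (\<Sum>x<n. \<Sum>y<n. M x y * kdelta y x)"
    unfolding sum_distrib_left[symmetric]
    by (intro sum.cong refl) (simp add: orthonormal_complete[OF assms])
  also have "\<dots> = ktrace n M"
    by (simp add: ktrace_def kdelta_def if_distrib[of "\<lambda>c. _ * c"] cong: if_cong)
  finally show ?thesis .
qed

lemma eigenbasis_orthonormal: "eigenbasis n M e a \<Longrightarrow> orthonormal n n e"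
  by (simp add: eigenbasis_def)

lemma sesq_eigenbasis:
  assumes "eigenbasis n M e a"
  shows "sesq n M f g = (\<Sum>i<n. of_real (a i) * (cinner n f (e i) * cinner n (e i) g))"
proof -
  have "sesq n M f g = sesq n (\<lambda>x y. \<Sum>i<n. of_real (a i) * (e i x * cnj (e i y))) f g"
    using assms by (intro sesq_cong) (auto simp: eigenbasis_def)
  then show ?thesis by (simp add: sesq_sum sesq_scale sesq_rank_one)
qed

lemma Re_sesq_eigenbasis:
  assumes "eigenbasis n M e a"
  shows "Re (sesq n M f f) = (\<Sum>i<n. a i * cmod2 (cinner n (e i) f))"
proof -
  have "cinner n f (e i) * cinner n (e i) f = of_real (cmod2 (cinner n (e i) f))" for i
    unfolding complex_norm_square by (simp add: cnj_cinner mult.commute)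
  then show ?thesis by (simp add: sesq_eigenbasis[OF assms])
qed

lemma sesq_eigenvectors:
  assumes "eigenbasis n M e a" "i < n" "j < n"
  shows "sesq n M (e i) (e j) = of_real (a i) * kdelta i j"
proof -
  have "sesq n M (e i) (e j) = (\<Sum>l<n. if l = i then of_real (a i) * kdelta i j else 0)"
    unfolding sesq_eigenbasis[OF assms(1)]
    using assms(2,3) orthonormalD[OF eigenbasis_orthonormal[OF assms(1)]]
    by (intro sum.cong refl) (auto simp: kdelta_def)
  then show ?thesis using assms by simp
qed

lemma ktrace_eigenbasis: "eigenbasis n M e a \<Longrightarrow> ktrace n M = of_real (\<Sum>i<n. a i)"
  using ktrace_orthonormal[OF eigenbasis_orthonormal, of n M e a M] sesq_eigenvectors[of n M e a]
  by (simp add: kdelta_def)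

lemma eigenbasisI:
  assumes orthonormal: "orthonormal n n e"
    and diag: "\<And>i j. i < n \<Longrightarrow> j < n \<Longrightarrow> sesq n M (e i) (e j) = of_real (a i) * kdelta i j"
  shows "eigenbasis n M e a"
proof -
  have "M x y = (\<Sum>i<n. of_real (a i) * (e i x * cnj (e i y)))" if indices: "x < n" "y < n" for x y
  proof -
    have complete: "(\<Sum>i<n. cnj (e i z) * e i u) = kdelta u z" if "u < n" "z < n" for u z
      using orthonormal_complete[OF orthonormal that] by (simp add: mult.commute)
    have "M x y = (\<Sum>u<n. \<Sum>v<n. kdelta u x * M u v * kdelta v y)"
      using indices
      by (simp add: kdelta_def if_distrib[of "\<lambda>c. _ * c"] if_distrib[of "\<lambda>c. c * _"] cong: if_cong)
    also have "\<dots> = sesq n M (\<lambda>u. \<Sum>i<n. cnj (e i x) * e i u) (\<lambda>v. \<Sum>j<n. cnj (e j y) * e j v)"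
      unfolding sesq_eq
      by (intro sum.cong refl) (simp only: complete indices lessThan_iff cnj_kdelta)
    also have "\<dots> = (\<Sum>i<n. \<Sum>j<n. cnj (cnj (e i x)) * cnj (e j y) * sesq n M (e i) (e j))"
      by (rule sesq_sum_vectors)
    also have "\<dots> = (\<Sum>i<n. \<Sum>j<n. if j = i then of_real (a i) * (e i x * cnj (e i y)) else 0)"
      by (intro sum.cong refl) (auto simp: diag kdelta_def)
    finally show ?thesis by simp
  qed
  then show ?thesis using orthonormal by (simp add: eigenbasis_def)
qed

lemma eigenbasis_shift:
  assumes "eigenbasis n M e a"
  shows "eigenbasis n (\<lambda>x y. M x y + of_real s * kdelta x y) e (\<lambda>i. a i + s)"
proof (rule eigenbasisI)
  show "orthonormal n n e" using assms by (rule eigenbasis_orthonormal)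
  then show "sesq n (\<lambda>x y. M x y + of_real s * kdelta x y) (e i) (e j)
      = of_real (a i + s) * kdelta i j"
    if "i < n" "j < n" for i j
    using sesq_eigenvectors[OF assms that] orthonormalD[OF _ that]
    by (simp add: sesq_add sesq_scale sesq_kdelta ring_distribs)
qed

lemma ctrace_mult_commute:
  assumes "A \<in> carrier_mat n k" "B \<in> carrier_mat k n"
  shows "ctrace (A * B) = ctrace (B * A)"
proof -
  have "ctrace (A * B) = (\<Sum>i<n. \<Sum>l<k. A $$ (i, l) * B $$ (l, i))"
    using assms by (simp add: ctrace_def scalar_prod_def atLeast0LessThan)
  also have "\<dots> = (\<Sum>l<k. \<Sum>i<n. B $$ (l, i) * A $$ (i, l))"
    by (subst sum.swap) (simp add: mult.commute)
  also have "\<dots> = ctrace (B * A)"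
    using assms by (simp add: ctrace_def scalar_prod_def atLeast0LessThan)
  finally show ?thesis .
qed

lemma ctrace_eq_sum_list_roots:
  assumes carrier: "A \<in> carrier_mat n n" and char_poly: "char_poly A = (\<Prod>a\<leftarrow>as. [:- a, 1:])"
  shows "ctrace A = sum_list as"
proof -
  obtain U P Q where schur: "schur_decomposition A as = (U, P, Q)"
    by (cases "schur_decomposition A as")
  from schur_decomposition[OF carrier char_poly schur]
  have similar: "similar_mat_wit A U P Q" and diag: "diag_mat U = as" by auto
  from similar_mat_witD2[OF carrier similar]
  have factor_carriers: "U \<in> carrier_mat n n" "P \<in> carrier_mat n n" "Q \<in> carrier_mat n n"
    and inverse: "Q * P = 1\<^sub>m n" and factorization: "A = P * U * Q" by auto
  have "ctrace A = ctrace (Q * (P * U))"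
    unfolding factorization using factor_carriers by (intro ctrace_mult_commute[of _ n n]) auto
  also have "Q * (P * U) = U"
    using factor_carriers inverse by (simp add: assoc_mult_mat[symmetric, of _ n n _ n _ n])
  also have "ctrace U = sum_list (diag_mat U)"
    by (simp add: ctrace_def diag_mat_def sum_list_sum_nth atLeast0LessThan)
  finally show ?thesis using diag by simp
qed

lemma nonzero_eigenvalue_exists:
  assumes "ktrace n M \<noteq> 0"
  shows "\<exists>z v. z \<noteq> 0 \<and> (\<exists>x<n. v x \<noteq> 0) \<and> (\<forall>x<n. kernel_app n M v x = z * v x)"
proof -
  define A where "A = mat n n (\<lambda>(x, y). M x y)"
  have carrier: "A \<in> carrier_mat n n" by (simp add: A_def)
  obtain as where char_poly: "char_poly A = (\<Prod>a\<leftarrow>as. [:- a, 1:])"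
    using char_poly_factorized[OF carrier] by blast
  have "sum_list as \<noteq> 0"
    using assms ctrace_eq_sum_list_roots[OF carrier char_poly]
    by (simp add: ctrace_def ktrace_def A_def)
  then obtain z where root: "z \<in> set as" "z \<noteq> 0" by (metis sum_list_neutral)
  have "poly (char_poly A) z = 0"
    unfolding char_poly using root(1) by (simp add: poly_prod_list prod_list_zero_iff image_iff)
  then obtain v where eigenvector: "v \<in> carrier_vec n" "v \<noteq> 0\<^sub>v n" "A *\<^sub>v v = z \<cdot>\<^sub>v v"
    using carrier eigenvalue_root_char_poly[OF carrier] unfolding eigenvalue_def eigenvector_def
    by auto
  show ?thesis
  proof (intro exI[of _ z] exI[of _ "($) v"] conjI allI impI)
    show "z \<noteq> 0" by fact
    show "\<exists>x<n. v $ x \<noteq> 0" using eigenvector(1,2) by (auto simp: vec_eq_iff)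
    show "kernel_app n M (($) v) x = z * v $ x" if "x < n" for x
      using arg_cong[OF eigenvector(3), of "\<lambda>w. w $ x"] that eigenvector(1)
      by (simp add: A_def kernel_app_def scalar_prod_def atLeast0LessThan)
  qed
qed

definition hermitian_kernel :: "nat \<Rightarrow> kernel \<Rightarrow> bool" where
  "hermitian_kernel n M \<longleftrightarrow> (\<forall>f g. sesq n M g f = cnj (sesq n M f g))"

definition deflation :: "nat \<Rightarrow> kernel \<Rightarrow> (nat \<Rightarrow> cvec) \<Rightarrow> (nat \<Rightarrow> real) \<Rightarrow> real \<Rightarrow> kernel" where
  "deflation k M e a s x y =
    M x y + of_real s * kdelta x y - (\<Sum>i<k. of_real (a i + s) * (e i x * cnj (e i y)))"

lemma kernel_app_deflation:
  assumes "x < n"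
  shows "kernel_app n (deflation k M e a s) f x
    = kernel_app n M f x + of_real s * f x - (\<Sum>i<k. of_real (a i + s) * cinner n (e i) f * e i x)"
proof -
  have "(\<Sum>y<n. of_real s * kdelta x y * f y) = of_real s * f x"
    using assms
    by (simp add: kdelta_def if_distrib[of "\<lambda>c. c * _"] if_distrib[of "\<lambda>c. _ * c"] cong: if_cong)
  moreover have "(\<Sum>y<n. (\<Sum>i<k. of_real (a i + s) * (e i x * cnj (e i y))) * f y)
    = (\<Sum>i<k. of_real (a i + s) * cinner n (e i) f * e i x)"
    unfolding sum_distrib_right cinner_def sum_distrib_left by (subst sum.swap) (simp add: mult_ac)
  ultimately show ?thesis
    by (simp add: kernel_app_def deflation_def left_diff_distrib distrib_right sum.distrib
        sum_subtractf)
qed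

lemma ktrace_deflation:
  assumes "orthonormal n k e"
  shows "ktrace n (deflation k M e a s)
      = ktrace n M - of_real (\<Sum>i<k. a i) + of_real s * (of_nat n - of_nat k)"
proof -
  have "(\<Sum>x<n. \<Sum>i<k. of_real (a i + s) * (e i x * cnj (e i x)))
    = (\<Sum>i<k. of_real (a i + s) * cinner n (e i) (e i))"
    unfolding cinner_def sum_distrib_left by (subst sum.swap) (simp add: mult_ac)
  also have "\<dots> = (\<Sum>i<k. of_real (a i + s))"
    by (intro sum.cong refl) (simp add: orthonormalD[OF assms] kdelta_def)
  finally show ?thesis
    by (simp add: ktrace_def deflation_def kdelta_def sum.distrib sum_subtractf algebra_simps)
qed

text \<open>The deflation is chosen to annihilate the known eigenvectors and to have nonzero trace: its
  eigenvectors for nonzero eigenvalues are then orthogonal to the known ones.\<close>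

lemma deflation_eigenvector_orthogonal:
  assumes hermitian: "hermitian_kernel n M" and orthonormal: "orthonormal n k e"
    and eigenvectors: "\<And>i x. i < k \<Longrightarrow> x < n \<Longrightarrow> kernel_app n M (e i) x = of_real (a i) * e i x"
    and deflated: "\<And>x. x < n \<Longrightarrow> kernel_app n (deflation k M e a s) v x = z * v x"
    and "z \<noteq> 0" "j < k"
  shows "cinner n (e j) v = 0"
proof -
  have app_v: "kernel_app n M v x
      = (z - of_real s) * v x + (\<Sum>i<k. of_real (a i + s) * cinner n (e i) v * e i x)"
    if "x < n" for x
    using deflated[OF that] by (simp add: kernel_app_deflation[OF that] algebra_simps)
  have "sesq n M v (e j) = cinner n v (\<lambda>x. of_real (a j) * e j x)"
    unfolding sesq_def by (rule cinner_cong) (simp_all add: eigenvectors \<open>j < k\<close>)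
  moreover have "sesq n M (e j) v = cnj (sesq n M v (e j))"
    using hermitian unfolding hermitian_kernel_def by blast
  ultimately have "of_real (a j) * cinner n (e j) v = sesq n M (e j) v"
    by (simp add: cinner_scale_right cnj_cinner)
  also have "\<dots> = cinner n (e j) (\<lambda>x. (z - of_real s) * v x
      + (\<Sum>i<k. of_real (a i + s) * cinner n (e i) v * e i x))"
    unfolding sesq_def by (rule cinner_cong) (simp_all add: app_v)
  also have "\<dots> = (z - of_real s) * cinner n (e j) v
      + (\<Sum>i<k. of_real (a i + s) * cinner n (e i) v * cinner n (e j) (e i))"
    by (simp only: cinner_add_right cinner_scale_right cinner_sum_right)
  also have "(\<Sum>i<k. of_real (a i + s) * cinner n (e i) v * cinner n (e j) (e i))
      = (\<Sum>i<k. if i = j then of_real (a j + s) * cinner n (e j) v else 0)"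
    by (intro sum.cong refl) (simp add: orthonormalD[OF orthonormal \<open>j < k\<close>] kdelta_def)
  finally have "z * cinner n (e j) v = 0" using \<open>j < k\<close> by (simp add: algebra_simps)
  then show ?thesis using \<open>z \<noteq> 0\<close> by simp
qed

lemma hermitian_next_eigenvector:
  assumes hermitian: "hermitian_kernel n M" and k_less: "k < n" and orthonormal: "orthonormal n k e"
    and eigenvectors: "\<And>i x. i < k \<Longrightarrow> x < n \<Longrightarrow> kernel_app n M (e i) x = of_real (a i) * e i x"
  obtains v \<mu> where "\<exists>x<n. v x \<noteq> 0" "\<And>i. i < k \<Longrightarrow> cinner n (e i) v = 0"
    "\<And>x. x < n \<Longrightarrow> kernel_app n M v x = \<mu> * v x"
proof -
  obtain s :: real where "ktrace n (deflation k M e a s) \<noteq> 0"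
  proof (cases "ktrace n (deflation k M e a 0) = 0")
    case True
    then have "ktrace n (deflation k M e a 1) \<noteq> 0"
      using k_less by (simp add: ktrace_deflation[OF orthonormal])
    then show ?thesis by (rule that)
  qed (rule that)
  from nonzero_eigenvalue_exists[OF this]
  obtain z v where z_nonzero: "z \<noteq> 0" and v_nonzero: "\<exists>x<n. v x \<noteq> 0"
    and deflated: "\<And>x. x < n \<Longrightarrow> kernel_app n (deflation k M e a s) v x = z * v x" by blast
  note orthogonal =
    deflation_eigenvector_orthogonal[OF hermitian orthonormal eigenvectors deflated z_nonzero]
  have "kernel_app n M v x = (z - of_real s) * v x" if "x < n" for x
    using deflated[OF that] by (simp add: kernel_app_deflation[OF that] orthogonal algebra_simps)
  with v_nonzero orthogonal show ?thesis by (rule that)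
qed

lemma hermitian_eigenvalue_real:
  assumes hermitian: "hermitian_kernel n M" and v_nonzero: "\<exists>x<n. v x \<noteq> 0"
    and eigenvector: "\<And>x. x < n \<Longrightarrow> kernel_app n M v x = \<mu> * v x"
  shows "\<mu> = of_real (Re \<mu>)"
proof -
  have "sesq n M v v = cinner n v (\<lambda>x. \<mu> * v x)"
    unfolding sesq_def by (rule cinner_cong) (simp_all add: eigenvector)
  then have "\<mu> * cinner n v v = cnj (\<mu> * cinner n v v)"
    using hermitian unfolding hermitian_kernel_def cinner_scale_right by metis
  moreover have "(\<Sum>x<n. cmod2 (v x)) > 0" using v_nonzero by (rule sum_cmod2_pos)
  ultimately have "\<mu> = cnj \<mu>" by (simp add: cinner_self del: of_real_sum)
  then show ?thesis by (simp add: complex_eq_iff)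
qed

lemma normalize_cvec:
  assumes "\<exists>x<n. v x \<noteq> 0"
  obtains c :: real where "cinner n (\<lambda>x. of_real c * v x) (\<lambda>x. of_real c * v x) = 1"
proof -
  define c where "c = 1 / sqrt (\<Sum>x<n. cmod2 (v x))"
  have "c\<^sup>2 * (\<Sum>x<n. cmod2 (v x)) = 1"
    using sum_cmod2_pos[OF assms] by (simp add: c_def power_divide)
  then have "(\<Sum>x<n. cmod2 (of_real c * v x)) = 1"
    by (simp add: norm_mult power_mult_distrib flip: sum_distrib_left)
  then show ?thesis using that[of c] by (simp only: cinner_self of_real_1)
qed

lemma hermitian_orthonormal_eigenvectors:
  assumes hermitian: "hermitian_kernel n M" and "k \<le> n"
  shows "\<exists>e (a :: nat \<Rightarrow> real). orthonormal n k e \<and>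
    (\<forall>i<k. \<forall>x<n. kernel_app n M (e i) x = of_real (a i) * e i x)"
  using \<open>k \<le> n\<close>
proof (induction k)
  case 0 show ?case by (simp add: orthonormal_def)
next
  case (Suc k)
  obtain e and a :: "nat \<Rightarrow> real" where orthonormal: "orthonormal n k e"
    and eigenvectors: "\<And>i x. i < k \<Longrightarrow> x < n \<Longrightarrow> kernel_app n M (e i) x = of_real (a i) * e i x"
    using Suc by auto
  have "k < n" using Suc.prems by simp
  from hermitian_next_eigenvector[OF hermitian this orthonormal eigenvectors]
  obtain v \<mu> where v_nonzero: "\<exists>x<n. v x \<noteq> 0"
    and orthogonal: "\<And>i. i < k \<Longrightarrow> cinner n (e i) v = 0"
    and v_eigenvector: "\<And>x. x < n \<Longrightarrow> kernel_app n M v x = \<mu> * v x" by blast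
  obtain c :: real where unit: "cinner n (\<lambda>x. of_real c * v x) (\<lambda>x. of_real c * v x) = 1"
    using normalize_cvec[OF v_nonzero] .
  define u where "u = (\<lambda>x. of_real c * v x)"
  have "cinner n u u = 1" using unit by (simp add: u_def)
  moreover have orthogonal_u: "cinner n (e i) u = 0" if "i < k" for i
    unfolding u_def cinner_scale_right using orthogonal[OF that] by simp
  moreover have "cinner n u (e i) = 0" if "i < k" for i
    using orthogonal_u[OF that] cnj_cinner[of n "e i" u] by simp
  ultimately have "orthonormal n (Suc k) (e(k := u))"
    using orthonormal by (auto simp: orthonormal_def less_Suc_eq kdelta_def)
  moreover have "kernel_app n M ((e(k := u)) i) x = of_real ((a(k := Re \<mu>)) i) * (e(k := u)) i x"
    if "i < Suc k" "x < n" for i x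
  proof (cases "i = k")
    case True
    have "kernel_app n M u x = of_real c * kernel_app n M v x"
      by (simp add: kernel_app_def u_def sum_distrib_left mult_ac)
    then have "kernel_app n M u x = \<mu> * u x" using v_eigenvector[OF that(2)] by (simp add: u_def)
    then show ?thesis
      using True hermitian_eigenvalue_real[OF hermitian v_nonzero v_eigenvector] by simp
  qed (use that eigenvectors in auto)
  ultimately show ?case by blast
qed

theorem hermitian_eigenbasis:
  assumes "hermitian_kernel n M"
  obtains e a where "eigenbasis n M e a"
proof -
  obtain e and a :: "nat \<Rightarrow> real" where orthonormal: "orthonormal n n e"
    and eigenvectors: "\<And>i x. i < n \<Longrightarrow> x < n \<Longrightarrow> kernel_app n M (e i) x = of_real (a i) * e i x"
    using hermitian_orthonormal_eigenvectors[OF assms order.refl] by blast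
  have "sesq n M (e i) (e j) = of_real (a i) * kdelta i j" if "i < n" "j < n" for i j
  proof -
    have "sesq n M (e i) (e j) = cinner n (e i) (\<lambda>x. of_real (a j) * e j x)"
      unfolding sesq_def by (rule cinner_cong) (simp_all add: eigenvectors that)
    then show ?thesis
      using orthonormalD[OF orthonormal that] by (simp add: cinner_scale_right kdelta_def)
  qed
  then show ?thesis using that eigenbasisI[OF orthonormal] by blast
qed

lemma pos_kernel_eigenbasis:
  assumes "pos_kernel n M"
  obtains e a where "eigenbasis n M e a" "\<And>i. i < n \<Longrightarrow> 0 \<le> a i"
proof -
  obtain e a where basis: "eigenbasis n M e a"
    using hermitian_eigenbasis pos_kernel_hermitian[OF assms] unfolding hermitian_kernel_def
    by blast
  have "0 \<le> a i" if "i < n" for i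
    using Re_sesq_nonneg[OF assms, of "e i"] sesq_eigenvectors[OF basis that that]
    by (simp add: kdelta_def)
  with basis show ?thesis by (rule that)
qed

definition posdef_kernel :: "nat \<Rightarrow> kernel \<Rightarrow> bool" where
  "posdef_kernel n M \<longleftrightarrow> pos_kernel n M \<and> (\<forall>f. (\<exists>x<n. f x \<noteq> 0) \<longrightarrow> 0 < Re (sesq n M f f))"

lemma posdef_kernel_imp_pos: "posdef_kernel n M \<Longrightarrow> pos_kernel n M"
  by (simp add: posdef_kernel_def)

lemma posdef_kernel_add_pos:
  "pos_kernel n M \<Longrightarrow> posdef_kernel n M' \<Longrightarrow> posdef_kernel n (\<lambda>x y. M x y + M' x y)"
  by (simp add: posdef_kernel_def pos_kernel_add sesq_add Re_sesq_nonneg add_nonneg_pos)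

lemma posdef_kernel_scaled_kdelta:
  assumes "0 < \<epsilon>"
  shows "posdef_kernel n (\<lambda>x y. of_real \<epsilon> * kdelta x y)"
proof -
  have "Re (sesq n (\<lambda>x y. of_real \<epsilon> * kdelta x y) f f) = \<epsilon> * (\<Sum>x<n. cmod2 (f x))" for f
    unfolding sesq_scale sesq_kdelta cinner_self by (simp flip: of_real_mult)
  then show ?thesis
    using assms sum_cmod2_pos unfolding posdef_kernel_def
    by (auto simp: pos_kernel_scale[OF pos_kernel_kdelta])
qed

lemma posdef_kernel_eigenvalue_pos:
  assumes "posdef_kernel n M" "eigenbasis n M e a" "i < n"
  shows "0 < a i"
proof -
  have "\<exists>x<n. e i x \<noteq> 0"
    using orthonormal_norm[OF eigenbasis_orthonormal[OF assms(2)] assms(3)] by (force intro: ccontr)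
  then show ?thesis
    using assms(1) sesq_eigenvectors[OF assms(2,3,3)] by (auto simp: posdef_kernel_def kdelta_def)
qed

section \<open>Entropy\<close>

lemma eta_eq: "0 \<le> x \<Longrightarrow> eta x = x * ln x"
  by (cases "x = 0") (auto simp: eta_def)

lemma eta_ge_tangent:
  assumes "0 \<le> x" "0 < b"
  shows "x * ln b + x - b \<le> eta x"
proof (cases "x = 0")
  case False
  then have "ln (b / x) \<le> b / x - 1" using assms by (intro ln_le_minus_one) simp
  then have "x * (ln b - ln x) \<le> x * (b / x - 1)"
    using False assms by (intro mult_left_mono) (simp_all add: ln_div)
  then show ?thesis using False assms by (simp add: eta_eq algebra_simps)
qed (use assms in \<open>simp add: eta_def\<close>)

lemma eta_sum_le:
  assumes "finite J" and w_nonneg: "\<And>j. j \<in> J \<Longrightarrow> 0 \<le> w j" and x_nonneg: "\<And>j. j \<in> J \<Longrightarrow> 0 \<le> x j"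
  shows "eta (\<Sum>j\<in>J. w j * x j) \<le> (\<Sum>j\<in>J. w j * eta (x j)) + (\<Sum>j\<in>J. w j * x j) * ln (\<Sum>j\<in>J. w j)"
proof (cases "(\<Sum>j\<in>J. w j * x j) = 0")
  case True
  then have "w j * eta (x j) = 0" if "j \<in> J" for j
    using that assms sum_nonneg_eq_0_iff[of J "\<lambda>j. w j * x j"] by (auto simp: eta_def)
  then show ?thesis using True by (simp add: eta_def)
next
  case False
  define W where "W = (\<Sum>j\<in>J. w j)"
  define b where "b = (\<Sum>j\<in>J. w j * x j)"
  have "0 \<le> W" "0 \<le> b"
    unfolding W_def b_def by (intro sum_nonneg mult_nonneg_nonneg w_nonneg x_nonneg; assumption)+
  moreover have "W \<noteq> 0"
  proof
    assume "W = 0"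
    then have "\<forall>j\<in>J. w j = 0" using assms(1) w_nonneg by (simp add: W_def sum_nonneg_eq_0_iff)
    then show False using False by simp
  qed
  ultimately have "0 < W" "0 < b" using False by (auto simp: b_def)
  then have "(\<Sum>j\<in>J. w j * (x j * ln (b / W) + x j - b / W)) \<le> (\<Sum>j\<in>J. w j * eta (x j))"
    by (intro sum_mono mult_left_mono eta_ge_tangent w_nonneg x_nonneg) auto
  also have "(\<Sum>j\<in>J. w j * (x j * ln (b / W) + x j - b / W)) = b * ln (b / W) + b - W * (b / W)"
    unfolding b_def W_def sum_distrib_right sum.distrib[symmetric] sum_subtractf[symmetric]
    by (intro sum.cong refl) (simp add: algebra_simps)
  also have "\<dots> = eta b - b * ln W"
    using \<open>0 < W\<close> \<open>0 < b\<close> by (simp add: ln_div eta_eq right_diff_distrib)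
  finally show ?thesis by (simp add: b_def W_def)
qed

lemma tendsto_eta_at_right_0:
  assumes "0 \<le> x"
  shows "((\<lambda>\<epsilon>. eta (x + \<epsilon>)) \<longlongrightarrow> eta x) (at_right 0)"
proof (rule Lim_transform_eventually)
  show "((\<lambda>\<epsilon>. (x + \<epsilon>) * ln (x + \<epsilon>)) \<longlongrightarrow> eta x) (at_right 0)"
  proof (cases "x = 0")
    case True
    have "((\<lambda>\<epsilon>. \<epsilon> * ln \<epsilon>) \<longlongrightarrow> 0) (at_right (0::real))" by real_asymp
    then show ?thesis using True by (simp add: eta_def)
  next
    case False
    then have "((\<lambda>\<epsilon>. (x + \<epsilon>) * ln (x + \<epsilon>)) \<longlongrightarrow> (x + 0) * ln (x + 0)) (at_right 0)"
      by (intro tendsto_intros) auto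
    then show ?thesis using assms by (simp add: eta_eq)
  qed
  show "\<forall>\<^sub>F \<epsilon> in at_right 0. (x + \<epsilon>) * ln (x + \<epsilon>) = eta (x + \<epsilon>)"
    unfolding eventually_at_filter using assms by (auto simp: eta_eq)
qed

definition kentropy :: "nat \<Rightarrow> kernel \<Rightarrow> real" where
  "kentropy n M = vn_entropy (mat n n (\<lambda>(x, y). M x y))"

lemma kentropy_cong:
  "(\<And>x y. x < n \<Longrightarrow> y < n \<Longrightarrow> M x y = M' x y) \<Longrightarrow> kentropy n M = kentropy n M'"
  unfolding kentropy_def by (intro arg_cong[where f = vn_entropy]) auto

lemma vn_entropy_eq_kentropy: "A \<in> carrier_mat n n \<Longrightarrow> vn_entropy A = kentropy n (entry A)"
  unfolding kentropy_def by (intro arg_cong[where f = vn_entropy]) auto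

lemma vn_entropy_char_poly:
  assumes char_poly: "char_poly A = (\<Prod>a\<leftarrow>map (\<lambda>i. of_real (a i)) [0..<n]. [:- a, 1:])"
  shows "vn_entropy A = - (\<Sum>i<n. eta (a i))"
proof -
  let ?Z = "{z. poly (char_poly A) z = 0}"
  have order: "Polynomial.order z (char_poly A) = (\<Sum>i<n. if z = of_real (a i) then 1 else 0)" for z
    unfolding char_poly by (subst order_prod_list)
      (auto simp: o_def order_linear' sum_list_sum_nth atLeast0LessThan intro!: sum.cong)
  have nonzero: "char_poly A \<noteq> 0" unfolding char_poly by (auto simp: prod_list_zero_iff)
  have root: "of_real (a i) \<in> ?Z" if "i < n" for i
    unfolding char_poly using that by (auto simp: poly_prod_list prod_list_zero_iff image_iff)
  have "(\<Sum>z\<in>?Z. real (Polynomial.order z (char_poly A)) * eta (Re z))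
    = (\<Sum>z\<in>?Z. \<Sum>i<n. if z = of_real (a i) then eta (a i) else 0)"
    unfolding order of_nat_sum sum_distrib_right by (intro sum.cong refl) auto
  also have "\<dots> = (\<Sum>i<n. \<Sum>z\<in>?Z. if z = of_real (a i) then eta (a i) else 0)"
    by (rule sum.swap)
  also have "\<dots> = (\<Sum>i<n. eta (a i))"
    by (intro sum.cong refl) (use poly_roots_finite[OF nonzero] root in simp)
  finally show ?thesis by (simp add: vn_entropy_def)
qed

lemma kentropy_eigenbasis:
  assumes "eigenbasis n M e a"
  shows "kentropy n M = - (\<Sum>i<n. eta (a i))"
proof -
  define A where "A = mat n n (\<lambda>(x, y). M x y)"
  define E where "E = mat n n (\<lambda>(x, i). e i x)"
  define F where "F = mat n n (\<lambda>(i, x). cnj (e i x))"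
  define D where "D = mat n n (\<lambda>(i, j). if i = j then complex_of_real (a i) else 0)"
  have carrier: "A \<in> carrier_mat n n" "E \<in> carrier_mat n n" "F \<in> carrier_mat n n"
      "D \<in> carrier_mat n n"
    by (auto simp: A_def E_def F_def D_def)
  note orthonormal_mat_inverse[OF eigenbasis_orthonormal[OF assms], folded E_def F_def]
  moreover have "E * D = mat n n (\<lambda>(x, i). of_real (a i) * e i x)"
    by (intro eq_matI) (auto simp: E_def D_def scalar_prod_def atLeast0LessThan
        if_distrib[of "\<lambda>c. _ * c"] cong: if_cong)
  then have "A = E * D * F"
    using assms by (intro eq_matI)
      (auto simp: A_def F_def scalar_prod_def atLeast0LessThan eigenbasis_def mult.assoc)
  ultimately have "similar_mat A D"
    unfolding similar_mat_def using carrier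
    by (intro exI[of _ E] exI[of _ F] similar_mat_witI[of _ _ n]) auto
  then have "char_poly A = char_poly D" by (rule char_poly_similar)
  also have "\<dots> = (\<Prod>a\<leftarrow>diag_mat D. [:- a, 1:])"
    by (rule char_poly_upper_triangular[OF carrier(4)]) (auto simp: D_def)
  also have "diag_mat D = map (\<lambda>i. of_real (a i)) [0..<n]" by (simp add: diag_mat_def D_def)
  finally show ?thesis unfolding kentropy_def A_def[symmetric] by (rule vn_entropy_char_poly)
qed

lemma peierls_inequality:
  assumes M_pos: "pos_kernel n M" and orthonormal: "orthonormal n n g"
  shows "kentropy n M \<le> - (\<Sum>l<n. eta (Re (sesq n M (g l) (g l))))"
proof -
  obtain e a where basis: "eigenbasis n M e a" and eigenvalues_nonneg: "\<And>i. i < n \<Longrightarrow> 0 \<le> a i"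
    using pos_kernel_eigenbasis[OF M_pos] by blast
  define w where "w i l = cmod2 (cinner n (e i) (g l))" for i l
  have rows: "(\<Sum>i<n. w i l) = 1" if "l < n" for l
    unfolding w_def parseval_norm[OF eigenbasis_orthonormal[OF basis]]
    by (rule orthonormal_norm[OF orthonormal that])
  have cols: "(\<Sum>l<n. w i l) = 1" if "i < n" for i
    unfolding w_def cmod_cinner_commute[of n "e i"] parseval_norm[OF orthonormal]
    by (rule orthonormal_norm[OF eigenbasis_orthonormal[OF basis] that])
  have "(\<Sum>l<n. eta (Re (sesq n M (g l) (g l)))) \<le> (\<Sum>l<n. \<Sum>i<n. w i l * eta (a i))"
  proof (intro sum_mono)
    fix l assume "l \<in> {..<n}"
    then have "eta (\<Sum>i<n. w i l * a i) \<le> (\<Sum>i<n. w i l * eta (a i))"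
      using eta_sum_le[of "{..<n}" "\<lambda>i. w i l" a] eigenvalues_nonneg rows[of l] by (simp add: w_def)
    then show "eta (Re (sesq n M (g l) (g l))) \<le> (\<Sum>i<n. w i l * eta (a i))"
      by (simp add: Re_sesq_eigenbasis[OF basis] w_def mult.commute)
  qed
  also have "\<dots> = (\<Sum>i<n. (\<Sum>l<n. w i l) * eta (a i))"
    by (subst sum.swap) (simp add: sum_distrib_right)
  also have "\<dots> = - kentropy n M" by (simp add: cols kentropy_eigenbasis[OF basis])
  finally show ?thesis by simp
qed

lemma kentropy_sum_ge:
  assumes "finite J" and w_nonneg: "\<And>j. j \<in> J \<Longrightarrow> 0 \<le> w j" and M_pos: "\<And>j. j \<in> J \<Longrightarrow> pos_kernel n (M j)"
    and trace_1: "\<And>j. j \<in> J \<Longrightarrow> ktrace n (M j) = 1"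
  shows "(\<Sum>j\<in>J. w j * kentropy n (M j)) - eta (\<Sum>j\<in>J. w j)
      \<le> kentropy n (\<lambda>x y. \<Sum>j\<in>J. of_real (w j) * M j x y)"
    (is "?lhs \<le> kentropy n ?S")
proof -
  define W where "W = (\<Sum>j\<in>J. w j)"
  have "pos_kernel n ?S" using w_nonneg M_pos by (intro pos_kernel_sum pos_kernel_scale)
  then obtain e a where basis: "eigenbasis n ?S e a" using pos_kernel_eigenbasis by blast
  define m where "m j i = Re (sesq n (M j) (e i) (e i))" for j i
  have eigenvalue_eq: "a i = (\<Sum>j\<in>J. w j * m j i)" if "i < n" for i
    using arg_cong[OF sesq_eigenvectors[OF basis that that], of Re]
    by (simp add: sesq_sum sesq_scale m_def kdelta_def)
  have "complex_of_real (\<Sum>i<n. a i) = of_real W"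
    unfolding ktrace_eigenbasis[OF basis, symmetric] ktrace_sum by (simp add: trace_1 W_def)
  then have "(\<Sum>i<n. a i) = W" by (simp only: of_real_eq_iff)
  moreover have "0 \<le> W" unfolding W_def by (intro sum_nonneg w_nonneg)
  ultimately have "eta W = (\<Sum>i<n. a i) * ln W" by (simp add: eta_eq)
  moreover have "(\<Sum>j\<in>J. w j * kentropy n (M j)) \<le> (\<Sum>j\<in>J. w j * - (\<Sum>i<n. eta (m j i)))"
    unfolding m_def
    by (intro sum_mono mult_left_mono peierls_inequality M_pos w_nonneg
        eigenbasis_orthonormal[OF basis])
  ultimately have "(\<Sum>j\<in>J. w j * kentropy n (M j)) - eta W
      \<le> (\<Sum>j\<in>J. w j * - (\<Sum>i<n. eta (m j i))) - (\<Sum>i<n. a i) * ln W" by simp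
  also have "\<dots> = - (\<Sum>i<n. (\<Sum>j\<in>J. w j * eta (m j i)) + a i * ln W)"
    by (simp add: sum_negf sum.distrib sum_distrib_left sum_distrib_right sum.swap[of _ J])
  also have "\<dots> \<le> - (\<Sum>i<n. eta (a i))"
    unfolding neg_le_iff_le
  proof (rule sum_mono)
    fix i assume "i \<in> {..<n}"
    then show "eta (a i) \<le> (\<Sum>j\<in>J. w j * eta (m j i)) + a i * ln W"
      using eta_sum_le[OF assms(1) w_nonneg, where x = "\<lambda>j. m j i"] Re_sesq_nonneg[OF M_pos]
      by (simp add: eigenvalue_eq m_def W_def)
  qed
  also have "\<dots> = kentropy n ?S" by (rule kentropy_eigenbasis[OF basis, symmetric])
  finally show ?thesis by (simp add: W_def)
qed

lemma tendsto_kentropy_shift: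
  assumes "pos_kernel n M"
  shows "((\<lambda>\<epsilon>. kentropy n (\<lambda>x y. M x y + of_real \<epsilon> * kdelta x y)) \<longlongrightarrow> kentropy n M) (at_right 0)"
proof -
  obtain e a where basis: "eigenbasis n M e a" and eigenvalues_nonneg: "\<And>i. i < n \<Longrightarrow> 0 \<le> a i"
    using pos_kernel_eigenbasis[OF assms] by blast
  show ?thesis
    unfolding kentropy_eigenbasis[OF basis] kentropy_eigenbasis[OF eigenbasis_shift[OF basis]]
    by (intro tendsto_minus tendsto_sum tendsto_eta_at_right_0) (simp add: eigenvalues_nonneg)
qed

lemma vn_entropy_density_nonneg:
  assumes "density n A"
  shows "0 \<le> vn_entropy A"
proof -
  have carrier: "A \<in> carrier_mat n n" and pos: "pos_kernel n (entry A)"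
    and trace: "ktrace n (entry A) = 1"
    using assms by (auto simp: density_iff)
  obtain e a where basis: "eigenbasis n (entry A) e a" and eigenvalues_nonneg: "\<And>i. i < n \<Longrightarrow> 0 \<le> a i"
    using pos_kernel_eigenbasis[OF pos] by blast
  have sum_eigenvalues: "(\<Sum>i<n. a i) = 1"
    using ktrace_eigenbasis[OF basis] trace by (metis of_real_eq_1_iff)
  have "eta (a i) \<le> 0" if "i < n" for i
  proof -
    have "a i \<le> (\<Sum>i<n. a i)" using that eigenvalues_nonneg by (intro member_le_sum) auto
    then show ?thesis using eigenvalues_nonneg[OF that] sum_eigenvalues
      by (cases "a i = 0") (auto simp: eta_eq mult_nonneg_nonpos)
  qed
  then have "(\<Sum>i<n. eta (a i)) \<le> 0" by (intro sum_nonpos) simp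
  then show ?thesis by (simp add: vn_entropy_eq_kentropy[OF carrier] kentropy_eigenbasis[OF basis])
qed

section \<open>Operator monotonicity of the logarithm\<close>

lemma two_Re_mult_le:
  fixes u z :: complex
  assumes "0 < a"
  shows "2 * Re (cnj u * z) - a * cmod2 z \<le> cmod2 u / a"
proof -
  have "0 \<le> cmod2 (u - of_real a * z) / a" using assms by simp
  also have "cmod2 (u - of_real a * z) = cmod2 u - 2 * a * Re (cnj u * z) + a\<^sup>2 * cmod2 z"
    unfolding cmod_power2 by (simp add: power2_eq_square algebra_simps)
  also have "\<dots> / a = cmod2 u / a - (2 * Re (cnj u * z) - a * cmod2 z)"
    using assms by (simp add: power2_eq_square field_simps)
  finally show ?thesis by simp
qed

lemma inverse_form_variational:
  assumes basis: "eigenbasis n M e a" and eigenvalues_pos: "\<And>i. i < n \<Longrightarrow> 0 < a i"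
  shows "2 * Re (cinner n v z) - Re (sesq n M z z) \<le> (\<Sum>i<n. cmod2 (cinner n (e i) v) / a i)"
proof -
  have "2 * Re (cinner n v z) - Re (sesq n M z z)
    = (\<Sum>i<n. 2 * Re (cnj (cinner n (e i) v) * cinner n (e i) z) - a i * cmod2 (cinner n (e i) z))"
    unfolding parseval[OF eigenbasis_orthonormal[OF basis], of v z] Re_sesq_eigenbasis[OF basis]
    by (simp add: sum_subtractf sum_distrib_left cnj_cinner)
  also have "\<dots> \<le> (\<Sum>i<n. cmod2 (cinner n (e i) v) / a i)"
    by (intro sum_mono two_Re_mult_le eigenvalues_pos) simp
  finally show ?thesis .
qed

text \<open>The variational bound for \<open>\<langle>v, M\<^sup>-\<^sup>1 v\<rangle>\<close> is taken at \<open>z = M'\<^sup>-\<^sup>1 v\<close>.\<close>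

lemma inverse_form_antimono:
  assumes basis: "eigenbasis n M e a" and eigenvalues_pos: "\<And>i. i < n \<Longrightarrow> 0 < a i"
    and basis': "eigenbasis n M' e' a'" and eigenvalues_pos': "\<And>i. i < n \<Longrightarrow> 0 < a' i"
    and forms_le: "\<And>f. Re (sesq n M f f) \<le> Re (sesq n M' f f)"
  shows "(\<Sum>i<n. cmod2 (cinner n (e' i) v) / a' i) \<le> (\<Sum>i<n. cmod2 (cinner n (e i) v) / a i)"
proof -
  define z where "z x = (\<Sum>i<n. (cinner n (e' i) v / of_real (a' i)) * e' i x)" for x
  have cinner_z: "cinner n (e' i) z = cinner n (e' i) v / of_real (a' i)" if "i < n" for i
  proof -
    have "cinner n (e' i) z = (\<Sum>j<n. if j = i then cinner n (e' i) v / of_real (a' i) else 0)"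
      unfolding z_def cinner_sum_right
      by (intro sum.cong refl)
        (simp add: orthonormalD[OF eigenbasis_orthonormal[OF basis']] that kdelta_def)
    then show ?thesis using that by simp
  qed
  have "cinner n v z = (\<Sum>i<n. cnj (cinner n (e' i) v) * (cinner n (e' i) v / of_real (a' i)))"
    unfolding parseval[OF eigenbasis_orthonormal[OF basis'], of v z] cnj_cinner
    by (simp add: cinner_z)
  also have "\<dots> = of_real (\<Sum>i<n. cmod2 (cinner n (e' i) v) / a' i)"
    unfolding of_real_sum of_real_divide complex_norm_square by (simp add: mult.commute)
  finally have cinner_v_z: "Re (cinner n v z) = (\<Sum>i<n. cmod2 (cinner n (e' i) v) / a' i)" by simp
  have "Re (sesq n M' z z) = (\<Sum>i<n. cmod2 (cinner n (e' i) v) / a' i)"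
    unfolding Re_sesq_eigenbasis[OF basis']
  proof (intro sum.cong refl)
    fix i assume "i \<in> {..<n}"
    then show "a' i * cmod2 (cinner n (e' i) z) = cmod2 (cinner n (e' i) v) / a' i"
      using eigenvalues_pos'[of i]
      by (simp add: cinner_z norm_divide power_divide power2_eq_square[of "a' i"])
  qed
  then have "(\<Sum>i<n. cmod2 (cinner n (e' i) v) / a' i) = 2 * Re (cinner n v z) - Re (sesq n M' z z)"
    using cinner_v_z by simp
  also have "\<dots> \<le> 2 * Re (cinner n v z) - Re (sesq n M z z)" using forms_le[of z] by simp
  also have "\<dots> \<le> (\<Sum>i<n. cmod2 (cinner n (e i) v) / a i)"
    by (rule inverse_form_variational[OF basis eigenvalues_pos])
  finally show ?thesis .
qed

lemma ln_form_mono: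
  assumes basis: "eigenbasis n M e a" and eigenvalues_pos: "\<And>i. i < n \<Longrightarrow> 0 < a i"
    and basis': "eigenbasis n M' e' a'" and eigenvalues_pos': "\<And>i. i < n \<Longrightarrow> 0 < a' i"
    and forms_le: "\<And>f. Re (sesq n M f f) \<le> Re (sesq n M' f f)"
  shows "(\<Sum>i<n. ln (a i) * cmod2 (cinner n (e i) v))
      \<le> (\<Sum>i<n. ln (a' i) * cmod2 (cinner n (e' i) v))"
proof -
  define c where "c i = cmod2 (cinner n (e i) v)" for i
  define c' where "c' i = cmod2 (cinner n (e' i) v)" for i
  define F where "F s = (\<Sum>i<n. c' i * ln (a' i + s)) - (\<Sum>i<n. c i * ln (a i + s))" for s
  have sum_c_eq: "(\<Sum>i<n. c' i) = (\<Sum>i<n. c i)"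
    unfolding c_def c'_def
    by (simp add: parseval_norm eigenbasis_orthonormal[OF basis] eigenbasis_orthonormal[OF basis'])
  have antimono: "F t \<le> F 0" if "0 \<le> t" for t
  proof (rule DERIV_nonpos_imp_nonincreasing[OF that])
    fix s assume s_bounds: "0 \<le> s" "s \<le> t"
    have pos: "0 < a i + s" "0 < a' i + s" if "i < n" for i
      using eigenvalues_pos[OF that] eigenvalues_pos'[OF that] s_bounds by auto
    have "(F has_real_derivative (\<Sum>i<n. c' i * (1 / (a' i + s)))
        - (\<Sum>i<n. c i * (1 / (a i + s)))) (at s)"
      unfolding F_def using pos by (auto intro!: derivative_eq_intros sum.cong simp: field_simps)
    moreover have "(\<Sum>i<n. c' i / (a' i + s)) \<le> (\<Sum>i<n. c i / (a i + s))"
      unfolding c_def c'_def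
      using forms_le pos
      by (intro inverse_form_antimono[OF eigenbasis_shift[OF basis] _ eigenbasis_shift[OF basis']])
        (auto simp: sesq_add sesq_scale sesq_kdelta)
    ultimately show "\<exists>y. (F has_real_derivative y) (at s) \<and> y \<le> 0" by auto
  qed
  have "F = (\<lambda>t. (\<Sum>i<n. c' i * (ln (a' i + t) - ln t)) - (\<Sum>i<n. c i * (ln (a i + t) - ln t)))"
    using sum_c_eq
    by (simp add: fun_eq_iff F_def right_diff_distrib sum_subtractf flip: sum_distrib_right)
  moreover have ln_limit: "((\<lambda>t. ln (b + t) - ln t) \<longlongrightarrow> 0) at_top" for b :: real by real_asymp
  have "((\<lambda>t. (\<Sum>i<n. c' i * (ln (a' i + t) - ln t)) - (\<Sum>i<n. c i * (ln (a i + t) - ln t)))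
      \<longlongrightarrow> (\<Sum>i<n. c' i * 0) - (\<Sum>i<n. c i * 0)) at_top"
    by (intro tendsto_diff tendsto_sum tendsto_mult tendsto_const ln_limit)
  ultimately have "(F \<longlongrightarrow> 0) at_top" by simp
  then have "0 \<le> F 0"
    using antimono
    by (rule tendsto_upperbound[OF _ eventually_mono[OF eventually_ge_at_top[of 0]]]) auto
  then show ?thesis by (simp add: F_def c_def c'_def mult.commute)
qed

text \<open>\<open>Tr C ln M\<close> for \<open>M = \<Sum>\<^sub>i a\<^sub>i |e\<^sub>i\<rangle>\<langle>e\<^sub>i|\<close>.\<close>

definition trace_ln :: "nat \<Rightarrow> kernel \<Rightarrow> (nat \<Rightarrow> cvec) \<Rightarrow> (nat \<Rightarrow> real) \<Rightarrow> real" where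
  "trace_ln n C e a = (\<Sum>i<n. Re (sesq n C (e i) (e i)) * ln (a i))"

lemma trace_ln_mono:
  assumes C_pos: "pos_kernel n C"
    and M_basis: "posdef_kernel n M" "eigenbasis n M e a"
    and M'_basis: "posdef_kernel n M'" "eigenbasis n M' e' a'"
    and forms_le: "\<And>f. Re (sesq n M f f) \<le> Re (sesq n M' f f)"
  shows "trace_ln n C e a \<le> trace_ln n C e' a'"
proof -
  obtain u c where C_basis: "eigenbasis n C u c" and c_nonneg: "\<And>k. k < n \<Longrightarrow> 0 \<le> c k"
    using pos_kernel_eigenbasis[OF C_pos] by blast
  have expand: "trace_ln n C g b = (\<Sum>k<n. c k * (\<Sum>i<n. ln (b i) * cmod2 (cinner n (g i) (u k))))"
    for g b
    unfolding trace_ln_def Re_sesq_eigenbasis[OF C_basis] sum_distrib_right sum_distrib_left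
    by (subst sum.swap) (simp add: cmod_cinner_commute[of n "u _"] mult_ac)
  show ?thesis
    unfolding expand using M_basis M'_basis forms_le
    by (intro sum_mono mult_left_mono ln_form_mono[OF M_basis(2) _ M'_basis(2)])
      (auto simp: c_nonneg intro: posdef_kernel_eigenvalue_pos)
qed

lemma klein_inequality:
  assumes M_basis: "posdef_kernel n M" "eigenbasis n M e a"
    and sum_pos: "pos_kernel n (\<lambda>x y. M x y + C x y)"
  shows "kentropy n (\<lambda>x y. M x y + C x y) \<le> kentropy n M - trace_ln n C e a - Re (ktrace n C)"
proof -
  have eigenvalues_pos: "0 < a i" if "i < n" for i
    by (rule posdef_kernel_eigenvalue_pos[OF M_basis that])
  define m where "m i = Re (sesq n C (e i) (e i))" for i
  have sum_m: "(\<Sum>i<n. m i) = Re (ktrace n C)"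
    using ktrace_orthonormal[OF eigenbasis_orthonormal[OF M_basis(2)], of C]
    by (simp add: m_def flip: Re_sum)
  have diag: "Re (sesq n (\<lambda>x y. M x y + C x y) (e i) (e i)) = a i + m i" if "i < n" for i
    using sesq_eigenvectors[OF M_basis(2) that that] by (simp add: sesq_add m_def kdelta_def)
  have "kentropy n (\<lambda>x y. M x y + C x y) \<le> - (\<Sum>i<n. eta (a i + m i))"
    using peierls_inequality[OF sum_pos eigenbasis_orthonormal[OF M_basis(2)]] by (simp add: diag)
  also have "\<dots> \<le> - (\<Sum>i<n. (a i + m i) * ln (a i) + (a i + m i) - a i)"
    unfolding neg_le_iff_le
  proof (intro sum_mono eta_ge_tangent)
    fix i assume "i \<in> {..<n}"
    then show "0 \<le> a i + m i" "0 < a i"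
      using Re_sesq_nonneg[OF sum_pos, of "e i"] diag eigenvalues_pos by auto
  qed
  also have "\<dots> = - (\<Sum>i<n. a i * ln (a i)) - trace_ln n C e a - Re (ktrace n C)"
    unfolding sum_m[symmetric] trace_ln_def m_def[symmetric]
    by (simp add: sum.distrib algebra_simps)
  also have "- (\<Sum>i<n. a i * ln (a i)) = kentropy n M"
    using eigenvalues_pos by (simp add: kentropy_eigenbasis[OF M_basis(2)] eta_eq less_imp_le)
  finally show ?thesis .
qed

section \<open>Entropy of balanced mixtures\<close>

definition mixture :: "nat \<Rightarrow> (nat \<Rightarrow> kernel) \<Rightarrow> kernel \<Rightarrow> (nat \<Rightarrow> real) \<Rightarrow> kernel" where
  "mixture d M Y q x y = (\<Sum>m<d. of_real (q m) * M m x y) + Y x y"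

definition balanced_eigenbasis ::
    "nat \<Rightarrow> nat \<Rightarrow> (nat \<Rightarrow> kernel) \<Rightarrow> kernel \<Rightarrow> (nat \<Rightarrow> cvec) \<Rightarrow> (nat \<Rightarrow> real) \<Rightarrow> bool" where
  "balanced_eigenbasis n d M N g b \<longleftrightarrow> eigenbasis n N g b \<and>
    (\<forall>l<n. \<forall>m<d. sesq n (M m) (g l) (g l) = sesq n (M 0) (g l) (g l))"

lemma sesq_mixture:
  "sesq n (mixture d M Y q) f g = (\<Sum>m<d. of_real (q m) * sesq n (M m) f g) + sesq n Y f g"
  unfolding mixture_def[abs_def] by (simp add: sesq_add sesq_sum sesq_scale)

lemma trace_ln_sum:
  "trace_ln n (\<lambda>x y. \<Sum>m\<in>I. of_real (c m) * M m x y) e a = (\<Sum>m\<in>I. c m * trace_ln n (M m) e a)"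
  unfolding trace_ln_def sesq_sum sesq_scale sum_distrib_left
  by (subst sum.swap) (simp add: sum_distrib_left sum_distrib_right mult_ac)

locale balanced_mixture =
  fixes n d :: nat and M :: "nat \<Rightarrow> kernel" and Y :: kernel
    and g :: "real \<Rightarrow> nat \<Rightarrow> cvec" and b :: "real \<Rightarrow> nat \<Rightarrow> real"
  assumes d_pos: "0 < d" and M_pos: "\<And>m. m < d \<Longrightarrow> pos_kernel n (M m)"
    and Y_posdef: "posdef_kernel n Y"
    and balanced: "\<And>t. 0 \<le> t \<Longrightarrow> balanced_eigenbasis n d M (mixture d M Y (\<lambda>_. t)) (g t) (b t)"
begin

abbreviation mix :: "(nat \<Rightarrow> real) \<Rightarrow> kernel" where
  "mix \<equiv> mixture d M Y"

lemma posdef_mix: "(\<And>m. m < d \<Longrightarrow> 0 \<le> q m) \<Longrightarrow> posdef_kernel n (mix q)"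
  unfolding mixture_def[abs_def]
  by (intro posdef_kernel_add_pos pos_kernel_sum pos_kernel_scale M_pos Y_posdef) auto

lemma Re_sesq_mix_mono:
  "(\<And>m. m < d \<Longrightarrow> q m \<le> q' m) \<Longrightarrow> Re (sesq n (mix q) f f) \<le> Re (sesq n (mix q') f f)"
  by (auto simp: sesq_mixture intro!: sum_mono mult_right_mono Re_sesq_nonneg M_pos)

lemma kentropy_mix_le:
  assumes q_nonneg: "\<And>m. m < d \<Longrightarrow> 0 \<le> q m" and q'_nonneg: "\<And>m. m < d \<Longrightarrow> 0 \<le> q' m"
    and basis: "eigenbasis n (mix q) e a"
  shows "kentropy n (mix q') \<le> kentropy n (mix q)
    - (\<Sum>m<d. (q' m - q m) * (trace_ln n (M m) e a + Re (ktrace n (M m))))"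
proof -
  define C where "C = (\<lambda>x y. \<Sum>m<d. of_real (q' m - q m) * M m x y)"
  have q'_eq: "mix q' = (\<lambda>x y. mix q x y + C x y)"
    by (simp add: fun_eq_iff mixture_def C_def left_diff_distrib sum_subtractf)
  have "kentropy n (mix q') \<le> kentropy n (mix q) - trace_ln n C e a - Re (ktrace n C)"
    using posdef_kernel_imp_pos[OF posdef_mix[of q', OF q'_nonneg]] unfolding q'_eq
    by (intro klein_inequality basis posdef_mix q_nonneg)
  then show ?thesis
    by (simp add: C_def trace_ln_sum ktrace_sum distrib_left sum.distrib del: of_real_diff)
qed

definition uniform_ln :: "real \<Rightarrow> real" where
  "uniform_ln t = trace_ln n (M 0) (g t) (b t)"

lemma eigenbasis_uniform: "0 \<le> t \<Longrightarrow> eigenbasis n (mix (\<lambda>_. t)) (g t) (b t)"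
  using balanced[of t] by (simp add: balanced_eigenbasis_def)

lemma sesq_uniform:
  "0 \<le> t \<Longrightarrow> m < d \<Longrightarrow> l < n \<Longrightarrow> sesq n (M m) (g t l) (g t l) = sesq n (M 0) (g t l) (g t l)"
  using balanced[of t] unfolding balanced_eigenbasis_def by blast

lemma trace_ln_uniform: "0 \<le> t \<Longrightarrow> m < d \<Longrightarrow> trace_ln n (M m) (g t) (b t) = uniform_ln t"
  unfolding uniform_ln_def trace_ln_def
  by (intro sum.cong refl arg_cong2[where f = "(*)"] arg_cong[where f = Re] sesq_uniform) auto

definition common_trace :: real where
  "common_trace = Re (ktrace n (M 0))"

lemma Re_ktrace_eq: "m < d \<Longrightarrow> Re (ktrace n (M m)) = common_trace"
  unfolding common_trace_def
    ktrace_orthonormal[OF eigenbasis_orthonormal[OF eigenbasis_uniform[OF order.refl]], symmetric]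
  by (intro arg_cong[where f = Re] sum.cong refl sesq_uniform) auto

lemma trace_ln_mix_le:
  assumes "\<And>m. m < d \<Longrightarrow> 0 \<le> q m" "\<And>m. m < d \<Longrightarrow> q m \<le> t" "0 \<le> t" "eigenbasis n (mix q) e a" "m < d"
  shows "trace_ln n (M m) e a \<le> uniform_ln t"
  unfolding trace_ln_uniform[OF assms(3,5), symmetric]
  using assms by (intro trace_ln_mono[where M = "mix q" and M' = "mix (\<lambda>_. t)"] M_pos posdef_mix
      eigenbasis_uniform Re_sesq_mix_mono) auto

lemma uniform_ln_mono: "0 \<le> t \<Longrightarrow> t \<le> t' \<Longrightarrow> uniform_ln t \<le> uniform_ln t'"
  using trace_ln_mix_le[of "\<lambda>_. t" t' _ _ 0] eigenbasis_uniform[of t] d_pos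
  by (simp add: uniform_ln_def)

lemma kentropy_mix_increment_ge:
  assumes q_nonneg: "\<And>m. m < d \<Longrightarrow> 0 \<le> q m" and q_le: "\<And>m. m < d \<Longrightarrow> q m \<le> q' m"
    and q'_le: "\<And>m. m < d \<Longrightarrow> q' m \<le> t" "0 \<le> t"
  shows "- (\<Sum>m<d. q' m - q m) * (uniform_ln t + common_trace)
      \<le> kentropy n (mix q') - kentropy n (mix q)"
proof -
  have q'_nonneg: "0 \<le> q' m" if "m < d" for m using q_nonneg q_le that by force
  obtain e a where basis: "eigenbasis n (mix q') e a"
    using pos_kernel_eigenbasis[OF posdef_kernel_imp_pos[OF posdef_mix[of q', OF q'_nonneg]]]
    by blast
  have "(\<Sum>m<d. (q' m - q m) * (trace_ln n (M m) e a + Re (ktrace n (M m))))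
    \<le> (\<Sum>m<d. (q' m - q m) * (uniform_ln t + common_trace))"
    using q_le trace_ln_mix_le[of q', OF q'_nonneg q'_le basis]
    by (intro sum_mono mult_left_mono) (auto simp: Re_ktrace_eq)
  moreover have "(\<Sum>m<d. (q m - q' m) * (trace_ln n (M m) e a + Re (ktrace n (M m))))
    = - (\<Sum>m<d. (q' m - q m) * (trace_ln n (M m) e a + Re (ktrace n (M m))))"
    unfolding sum_negf[symmetric] by (intro sum.cong refl) (simp add: algebra_simps)
  ultimately show ?thesis
    using kentropy_mix_le[of q' q, OF q'_nonneg q_nonneg basis]
    by (simp add: sum_distrib_right[symmetric])
qed

lemma kentropy_uniform_increment_le:
  assumes "0 \<le> t" "0 \<le> t'"
  shows "kentropy n (mix (\<lambda>_. t')) - kentropy n (mix (\<lambda>_. t))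
      \<le> - real d * (t' - t) * (uniform_ln t + common_trace)"
  using kentropy_mix_le[of "\<lambda>_. t" "\<lambda>_. t'", OF _ _ eigenbasis_uniform[OF assms(1)]] assms
  by (simp add: trace_ln_uniform Re_ktrace_eq)

definition gap :: "(nat \<Rightarrow> real) \<Rightarrow> real \<Rightarrow> real" where
  "gap r t = kentropy n (mix (\<lambda>m. min (r m) t)) - (\<Sum>m<d. kentropy n (mix (\<lambda>_. min (r m) t))) / d"

text \<open>Both entropies are bounded with the logarithm taken at opposite ends of the step; the
  resulting errors telescope to \<open>O(h)\<close> for steps of length \<open>h\<close>.\<close>

lemma gap_increment_ge:
  fixes t t' :: real
  assumes r_nonneg: "\<And>m. m < d \<Longrightarrow> 0 \<le> r m" and t_le: "0 \<le> t" "t \<le> t'"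
  shows "- (d * (t' - t) * (uniform_ln t' - uniform_ln t)) \<le> gap r t' - gap r t"
proof -
  define h where "h m = min (r m) t' - min (r m) t" for m
  have "- (\<Sum>m<d. h m) * (uniform_ln t' + common_trace)
      \<le> kentropy n (mix (\<lambda>m. min (r m) t')) - kentropy n (mix (\<lambda>m. min (r m) t))"
    unfolding h_def using r_nonneg t_le by (intro kentropy_mix_increment_ge) auto
  moreover have "(\<Sum>m<d. kentropy n (mix (\<lambda>_. min (r m) t')) - kentropy n (mix (\<lambda>_. min (r m) t)))
      \<le> (\<Sum>m<d. - real d * h m * (uniform_ln t + common_trace))"
  proof (rule sum_mono)
    fix m assume "m \<in> {..<d}"
    then have "0 \<le> r m" using r_nonneg by simp
    then have "kentropy n (mix (\<lambda>_. min (r m) t')) - kentropy n (mix (\<lambda>_. min (r m) t))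
        \<le> - real d * h m * (uniform_ln (min (r m) t) + common_trace)"
      unfolding h_def using t_le by (intro kentropy_uniform_increment_le) auto
    moreover have "h m = 0 \<or> min (r m) t = t" using t_le by (auto simp: h_def)
    ultimately show "kentropy n (mix (\<lambda>_. min (r m) t')) - kentropy n (mix (\<lambda>_. min (r m) t))
        \<le> - real d * h m * (uniform_ln t + common_trace)" by auto
  qed
  then have "(\<Sum>m<d. kentropy n (mix (\<lambda>_. min (r m) t')) - kentropy n (mix (\<lambda>_. min (r m) t))) / d
      \<le> - (\<Sum>m<d. h m) * (uniform_ln t + common_trace)"
    using d_pos by (simp add: divide_le_eq sum_distrib_left sum_distrib_right sum_negf mult_ac)
  moreover have "(\<Sum>m<d. h m) * (uniform_ln t' - uniform_ln t)
      \<le> d * (t' - t) * (uniform_ln t' - uniform_ln t)"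
  proof (rule mult_right_mono)
    have "(\<Sum>m<d. h m) \<le> (\<Sum>m<d. t' - t)" using t_le by (intro sum_mono) (auto simp: h_def)
    then show "(\<Sum>m<d. h m) \<le> d * (t' - t)" by simp
  qed (use uniform_ln_mono t_le in simp)
  ultimately show ?thesis by (simp add: gap_def sum_subtractf diff_divide_distrib algebra_simps)
qed

lemma gap_nonneg:
  fixes t :: real
  assumes r_nonneg: "\<And>m. m < d \<Longrightarrow> 0 \<le> r m" and t_nonneg: "0 \<le> t"
  shows "0 \<le> gap r t"
proof -
  have steps: "- (d * h * (uniform_ln (real k * h) - uniform_ln 0)) \<le> gap r (real k * h) - gap r 0"
    if "0 \<le> h" for h :: real and k :: nat
  proof (induction k)
    case (Suc k)
    have "- (d * h * (uniform_ln (real (Suc k) * h) - uniform_ln (real k * h)))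
        \<le> gap r (real (Suc k) * h) - gap r (real k * h)"
      using gap_increment_ge[of r "real k * h" "real (Suc k) * h", OF r_nonneg] that
      by (simp add: algebra_simps)
    with Suc show ?case by (simp add: algebra_simps)
  qed simp
  have "gap r 0 = 0"
  proof -
    have "kentropy n (mix (\<lambda>m. min (r m) 0)) = kentropy n (mix (\<lambda>_. 0))"
      by (rule kentropy_cong) (simp add: mixture_def min_absorb2 r_nonneg)
    then show ?thesis using d_pos r_nonneg by (simp add: gap_def min_absorb2)
  qed
  then have "- (d * t * (uniform_ln t - uniform_ln 0)) * inverse (real (Suc k)) \<le> gap r t" for k
    using steps[where h = "t / Suc k" and k = "Suc k"] t_nonneg
    by (simp add: divide_inverse mult_ac del: of_nat_Suc)
  moreover have "(\<lambda>k. - (d * t * (uniform_ln t - uniform_ln 0)) * inverse (real (Suc k))) \<longlonglongrightarrow>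
      - (d * t * (uniform_ln t - uniform_ln 0)) * 0"
    by (intro tendsto_mult tendsto_const LIMSEQ_inverse_real_of_nat)
  ultimately show ?thesis by (intro LIMSEQ_le_const2) auto
qed

lemma kentropy_mix_ge:
  assumes r_nonneg: "\<And>m. m < d \<Longrightarrow> 0 \<le> r m"
  shows "(\<Sum>m<d. kentropy n (mix (\<lambda>_. r m))) / d \<le> kentropy n (mix r)"
proof -
  define t where "t = (\<Sum>m<d. r m)"
  have min_eq: "min (r m) t = r m" if "m < d" for m
    using that r_nonneg unfolding t_def by (intro min_absorb1 member_le_sum) auto
  have "0 \<le> gap r t" using r_nonneg by (intro gap_nonneg) (auto simp: t_def intro: sum_nonneg)
  moreover have "kentropy n (mix (\<lambda>m. min (r m) t)) = kentropy n (mix r)"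
    by (rule kentropy_cong) (simp add: mixture_def min_eq)
  ultimately show ?thesis by (simp add: gap_def min_eq)
qed

end

theorem kentropy_mixture_ge:
  assumes d_pos: "0 < d" and M_pos: "\<And>m. m < d \<Longrightarrow> pos_kernel n (M m)" and Y_pos: "pos_kernel n Y"
    and balanced: "\<And>t. 0 \<le> t \<Longrightarrow> \<exists>g b. balanced_eigenbasis n d M (mixture d M Y (\<lambda>_. t)) g b"
    and r_nonneg: "\<And>m. m < d \<Longrightarrow> 0 \<le> r m"
  shows "(\<Sum>m<d. kentropy n (mixture d M Y (\<lambda>_. r m))) / d \<le> kentropy n (mixture d M Y r)"
proof (rule tendsto_le[OF trivial_limit_at_right_real])
  define Y' where "Y' \<epsilon> = (\<lambda>x y. Y x y + of_real \<epsilon> * kdelta x y)" for \<epsilon>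
  have shift: "mixture d M (Y' \<epsilon>) q = (\<lambda>x y. mixture d M Y q x y + of_real \<epsilon> * kdelta x y)" for \<epsilon> q
    by (simp add: fun_eq_iff mixture_def Y'_def)
  have limit: "((\<lambda>\<epsilon>. kentropy n (mixture d M (Y' \<epsilon>) q))
      \<longlongrightarrow> kentropy n (mixture d M Y q)) (at_right 0)"
    if "\<And>m. m < d \<Longrightarrow> 0 \<le> q m" for q
    unfolding shift using that
    by (intro tendsto_kentropy_shift)
      (auto simp: mixture_def[abs_def] intro!: pos_kernel_add pos_kernel_sum pos_kernel_scale M_pos
          Y_pos)
  obtain g b
    where basis: "\<And>t. 0 \<le> t \<Longrightarrow> balanced_eigenbasis n d M (mixture d M Y (\<lambda>_. t)) (g t) (b t)"
    using balanced by metis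
  show "((\<lambda>\<epsilon>. kentropy n (mixture d M (Y' \<epsilon>) r)) \<longlongrightarrow> kentropy n (mixture d M Y r)) (at_right 0)"
    by (rule limit[OF r_nonneg])
  show "((\<lambda>\<epsilon>. (\<Sum>m<d. kentropy n (mixture d M (Y' \<epsilon>) (\<lambda>_. r m))) / d)
      \<longlongrightarrow> (\<Sum>m<d. kentropy n (mixture d M Y (\<lambda>_. r m))) / d) (at_right 0)"
    using d_pos r_nonneg by (intro tendsto_divide tendsto_sum limit tendsto_const) auto
  have "(\<Sum>m<d. kentropy n (mixture d M (Y' \<epsilon>) (\<lambda>_. r m))) / d \<le> kentropy n (mixture d M (Y' \<epsilon>) r)"
    if "0 < \<epsilon>" for \<epsilon>
  proof -
    interpret balanced_mixture n d M "Y' \<epsilon>" g "\<lambda>t i. b t i + \<epsilon>"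
    proof
      show "posdef_kernel n (Y' \<epsilon>)"
        unfolding Y'_def by (intro posdef_kernel_add_pos Y_pos posdef_kernel_scaled_kdelta that)
      show "balanced_eigenbasis n d M (mixture d M (Y' \<epsilon>) (\<lambda>_. t)) (g t) (\<lambda>i. b t i + \<epsilon>)"
        if "0 \<le> t" for t
        using basis[OF that] eigenbasis_shift unfolding balanced_eigenbasis_def shift by blast
    qed (fact d_pos M_pos)+
    show ?thesis by (rule kentropy_mix_ge[OF r_nonneg])
  qed
  then show "\<forall>\<^sub>F \<epsilon> in at_right 0. (\<Sum>m<d. kentropy n (mixture d M (Y' \<epsilon>) (\<lambda>_. r m))) / d
      \<le> kentropy n (mixture d M (Y' \<epsilon>) r)"
    by (simp add: eventually_at_filter)
qed

section \<open>Tensor products and block-diagonal kernels\<close>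

lemma mult_add_less_mult:
  fixes i a d K :: nat
  assumes "i < d" "a < K"
  shows "i * K + a < d * K"
proof -
  have "i * K + a < Suc i * K" using assms(2) by simp
  also have "\<dots> \<le> d * K" using assms(1) by (intro mult_right_mono) auto
  finally show ?thesis .
qed

lemma less_mult_imp_mod_less:
  fixes l d K :: nat
  shows "l < d * K \<Longrightarrow> l mod K < K"
  by (cases "K = 0") auto

lemma kdelta_div_mod: "kdelta l l' = kdelta (l div K) (l' div K) * kdelta (l mod K) (l' mod K)"
proof -
  have "l = l' \<longleftrightarrow> l div K = l' div K \<and> l mod K = l' mod K" by (metis div_mult_mod_eq)
  then show ?thesis by (simp add: kdelta_def)
qed

lemma sum_div_mod:
  fixes F :: "nat \<Rightarrow> nat \<Rightarrow> 'a :: comm_monoid_add"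
  shows "(\<Sum>x<d * K. F (x div K) (x mod K)) = (\<Sum>i<d. \<Sum>a<K. F i a)"
proof (cases "K = 0")
  case False
  have "(\<Sum>x<d * K. F (x div K) (x mod K)) = (\<Sum>z\<in>{..<d} \<times> {..<K}. F (fst z) (snd z))"
    by (rule sum.reindex_bij_witness[of _ "\<lambda>z. fst z * K + snd z" "\<lambda>x. (x div K, x mod K)"])
      (use False in \<open>auto simp: less_mult_imp_div_less mult_add_less_mult\<close>)
  then show ?thesis by (simp add: sum.cartesian_product case_prod_unfold)
qed simp

definition tensor_vec :: "nat \<Rightarrow> cvec \<Rightarrow> cvec \<Rightarrow> cvec" where
  "tensor_vec K f g x = f (x div K) * g (x mod K)"

lemma cinner_tensor_vec:
  "cinner (d * K) (tensor_vec K f g) (tensor_vec K f' g') = cinner d f f' * cinner K g g'"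
proof -
  have "cinner (d * K) (tensor_vec K f g) (tensor_vec K f' g')
    = (\<Sum>i<d. \<Sum>a<K. (cnj (f i) * f' i) * (cnj (g a) * g' a))"
    unfolding sum_div_mod[symmetric] by (simp add: cinner_def tensor_vec_def mult_ac)
  then show ?thesis by (simp add: cinner_def sum_product)
qed

lemma sesq_tensor_vec:
  "sesq (d * K) M (tensor_vec K f g) (tensor_vec K f' g')
    = sesq K (\<lambda>a b. sesq d (\<lambda>i j. M (i * K + a) (j * K + b)) f f') g g'"
proof -
  let ?t = "\<lambda>i a j b. cnj (f i * g a) * M (i * K + a) (j * K + b) * (f' j * g' b)"
  have "sesq (d * K) M (tensor_vec K f g) (tensor_vec K f' g')
    = (\<Sum>x<d * K. \<Sum>y<d * K. ?t (x div K) (x mod K) (y div K) (y mod K))"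
    by (simp add: sesq_eq tensor_vec_def)
  also have "\<dots> = (\<Sum>x<d * K. \<Sum>j<d. \<Sum>b<K. ?t (x div K) (x mod K) j b)"
    by (intro sum.cong refl sum_div_mod)
  also have "\<dots> = (\<Sum>i<d. \<Sum>a<K. \<Sum>j<d. \<Sum>b<K. ?t i a j b)"
    by (rule sum_div_mod)
  also have "\<dots> = (\<Sum>i<d. \<Sum>a<K. \<Sum>b<K. \<Sum>j<d. ?t i a j b)"
    by (intro sum.cong refl sum.swap)
  also have "\<dots> = (\<Sum>a<K. \<Sum>b<K. \<Sum>i<d. \<Sum>j<d. ?t i a j b)"
    by (rule sum_rotate3)
  finally show ?thesis by (simp add: sesq_eq sum_distrib_left sum_distrib_right mult_ac)
qed

lemma orthonormal_tensor_vec: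
  assumes orthonormal_f: "orthonormal d d f" and orthonormal_g: "\<And>j. j < d \<Longrightarrow> orthonormal K K (g j)"
  shows "orthonormal (d * K) (d * K) (\<lambda>l. tensor_vec K (f (l div K)) (g (l div K) (l mod K)))"
  unfolding orthonormal_def
proof (intro allI impI)
  fix l l' assume "l < d * K" "l' < d * K"
  then have indices: "l div K < d" "l' div K < d" "l mod K < K" "l' mod K < K"
    by (auto simp: less_mult_imp_div_less less_mult_imp_mod_less)
  show "cinner (d * K) (tensor_vec K (f (l div K)) (g (l div K) (l mod K)))
      (tensor_vec K (f (l' div K)) (g (l' div K) (l' mod K))) = kdelta l l'"
    unfolding cinner_tensor_vec kdelta_div_mod[of l l' K]
      orthonormalD[OF orthonormal_f indices(1,2)]
    using orthonormalD[OF orthonormal_g[OF indices(1)] indices(3,4)]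
    by (cases "l div K = l' div K") (simp_all add: kdelta_def)
qed

definition block_diagonal :: "nat \<Rightarrow> nat \<Rightarrow> (nat \<Rightarrow> cvec) \<Rightarrow> kernel \<Rightarrow> (nat \<Rightarrow> kernel) \<Rightarrow> bool" where
  "block_diagonal d K f M B \<longleftrightarrow> (\<forall>j<d. \<forall>j'<d. \<forall>g g'.
    sesq (d * K) M (tensor_vec K (f j) g) (tensor_vec K (f j') g')
      = kdelta j j' * sesq K (B j) g g')"

lemma block_diagonal_sum_scale:
  assumes "\<And>i. i \<in> I \<Longrightarrow> block_diagonal d K f (M i) (B i)"
  shows "block_diagonal d K f (\<lambda>x y. \<Sum>i\<in>I. c i * M i x y) (\<lambda>j a b. \<Sum>i\<in>I. c i * B i j a b)"
  using assms by (simp add: block_diagonal_def sesq_sum sesq_scale sum_distrib_left mult_ac)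

lemma eigenbasis_blocks:
  assumes orthonormal: "orthonormal d d f" and blocks: "block_diagonal d K f M B"
    and block_basis: "\<And>j. j < d \<Longrightarrow> eigenbasis K (B j) (g j) (b j)"
  shows "eigenbasis (d * K) M (\<lambda>l. tensor_vec K (f (l div K)) (g (l div K) (l mod K)))
    (\<lambda>l. b (l div K) (l mod K))"
proof (rule eigenbasisI)
  show "orthonormal (d * K) (d * K) (\<lambda>l. tensor_vec K (f (l div K)) (g (l div K) (l mod K)))"
    by (rule orthonormal_tensor_vec[OF orthonormal eigenbasis_orthonormal[OF block_basis]])
  fix l l' assume "l < d * K" "l' < d * K"
  then have indices: "l div K < d" "l' div K < d" "l mod K < K" "l' mod K < K"
    by (auto simp: less_mult_imp_div_less less_mult_imp_mod_less)
  show "sesq (d * K) M (tensor_vec K (f (l div K)) (g (l div K) (l mod K)))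
        (tensor_vec K (f (l' div K)) (g (l' div K) (l' mod K)))
      = of_real (b (l div K) (l mod K)) * kdelta l l'"
    using blocks indices sesq_eigenvectors[OF block_basis[OF indices(1)] indices(3,4)]
    unfolding block_diagonal_def kdelta_div_mod[of l l' K]
    by (cases "l div K = l' div K") (simp_all add: kdelta_def)
qed

lemma kentropy_blocks:
  assumes orthonormal: "orthonormal d d f" and blocks: "block_diagonal d K f M B"
    and B_pos: "\<And>j. j < d \<Longrightarrow> pos_kernel K (B j)"
  shows "kentropy (d * K) M = (\<Sum>j<d. kentropy K (B j))"
proof -
  have "\<forall>j<d. \<exists>g b. eigenbasis K (B j) g b" using pos_kernel_eigenbasis[OF B_pos] by metis
  then obtain g b where block_basis: "\<And>j. j < d \<Longrightarrow> eigenbasis K (B j) (g j) (b j)" by metis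
  have "kentropy (d * K) M = - (\<Sum>l<d * K. eta (b (l div K) (l mod K)))"
    by (rule kentropy_eigenbasis[OF eigenbasis_blocks[OF orthonormal blocks block_basis]])
  also have "\<dots> = (\<Sum>j<d. - (\<Sum>a<K. eta (b j a)))"
    by (simp add: sum_negf sum_div_mod[where F = "\<lambda>j a. eta (b j a)"])
  finally show ?thesis by (simp add: kentropy_eigenbasis[OF block_basis])
qed

definition conj_kernel :: "nat \<Rightarrow> kernel \<Rightarrow> kernel \<Rightarrow> kernel" where
  "conj_kernel n V M x y = (\<Sum>u<n. \<Sum>v<n. V x u * M u v * cnj (V y v))"

definition kernel_adj :: "kernel \<Rightarrow> kernel" where
  "kernel_adj V x y = cnj (V y x)"

text \<open>The kernel of \<open>W \<otimes> 1\<close>.\<close>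

definition amplify :: "nat \<Rightarrow> complex mat \<Rightarrow> kernel" where
  "amplify K W x y = W $$ (x div K, y div K) * kdelta (x mod K) (y mod K)"

lemma sesq_conj_kernel:
  "sesq n (conj_kernel n V M) f g
      = sesq n M (kernel_app n (kernel_adj V) f) (kernel_app n (kernel_adj V) g)"
proof -
  have "sesq n (conj_kernel n V M) f g
      = (\<Sum>x<n. \<Sum>y<n. \<Sum>u<n. \<Sum>v<n. cnj (f x) * V x u * M u v * (cnj (V y v) * g y))"
    by (simp add: sesq_eq conj_kernel_def sum_distrib_left sum_distrib_right mult_ac)
  also have "\<dots> = (\<Sum>u<n. \<Sum>v<n. \<Sum>x<n. \<Sum>y<n. cnj (f x) * V x u * M u v * (cnj (V y v) * g y))"
    by (subst sum_rotate3[symmetric]) (intro sum.cong refl sum_rotate3[symmetric])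
  also have "\<dots> = sesq n M (kernel_app n (kernel_adj V) f) (kernel_app n (kernel_adj V) g)"
    by (simp add: sesq_eq kernel_app_def kernel_adj_def sum_distrib_left sum_distrib_right mult_ac)
  finally show ?thesis .
qed

lemma pos_kernel_conj: "pos_kernel n M \<Longrightarrow> pos_kernel n (conj_kernel n V M)"
  by (simp add: pos_kernel_def sesq_conj_kernel)

lemma sum_kdelta_mod:
  assumes "x < d * K"
  shows "(\<Sum>y<d * K. F (y div K) * kdelta (x mod K) (y mod K) * G y)
      = (\<Sum>i<d. F i * G (i * K + x mod K))"
proof -
  have "x mod K < K" using assms by (rule less_mult_imp_mod_less)
  have "(\<Sum>y<d * K. F (y div K) * kdelta (x mod K) (y mod K) * G y)
    = (\<Sum>y<d * K. F (y div K) * kdelta (x mod K) (y mod K) * G (y div K * K + y mod K))" by simp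
  also have "\<dots> = (\<Sum>i<d. \<Sum>a<K. if a = x mod K then F i * G (i * K + a) else 0)"
    unfolding sum_div_mod[where F = "\<lambda>i a. F i * kdelta (x mod K) a * G (i * K + a)"]
    by (intro sum.cong refl) (auto simp: kdelta_def)
  finally show ?thesis using \<open>x mod K < K\<close> by simp
qed

lemma conj_amplify_eq:
  assumes "x < d * K" "y < d * K"
  shows "conj_kernel (d * K) (amplify K W) M x y = (\<Sum>i<d. \<Sum>j<d.
    W $$ (x div K, i) * M (i * K + x mod K) (j * K + y mod K) * cnj (W $$ (y div K, j)))"
proof -
  have "conj_kernel (d * K) (amplify K W) M x y
    = (\<Sum>u<d * K. W $$ (x div K, u div K) * kdelta (x mod K) (u mod K) *
        (\<Sum>v<d * K. cnj (W $$ (y div K, v div K)) * kdelta (y mod K) (v mod K) * M u v))"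
    by (simp add: conj_kernel_def amplify_def sum_distrib_left mult_ac)
  also have "\<dots> = (\<Sum>i<d. W $$ (x div K, i) *
      (\<Sum>j<d. cnj (W $$ (y div K, j)) * M (i * K + x mod K) (j * K + y mod K)))"
    unfolding sum_kdelta_mod[OF assms(2), where F = "\<lambda>j. cnj (W $$ (y div K, j))"]
    by (rule sum_kdelta_mod[OF assms(1), where F = "\<lambda>i. W $$ (x div K, i)"])
  finally show ?thesis by (simp add: sum_distrib_left mult_ac)
qed

lemma kernel_app_adj_amplify_tensor_vec:
  assumes "x < d * K"
  shows "kernel_app (d * K) (kernel_adj (amplify K W)) (tensor_vec K f g) x
    = (\<Sum>i<d. cnj (W $$ (i, x div K)) * f i) * g (x mod K)"
proof -
  have "kernel_app (d * K) (kernel_adj (amplify K W)) (tensor_vec K f g) x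
    = (\<Sum>y<d * K. (cnj (W $$ (y div K, x div K)) * f (y div K)) * kdelta (x mod K) (y mod K)
        * g (y mod K))"
    unfolding kernel_app_def kernel_adj_def amplify_def tensor_vec_def
    by (intro sum.cong refl) (auto simp: kdelta_def)
  also have "\<dots> = (\<Sum>i<d. cnj (W $$ (i, x div K)) * f i * g ((i * K + x mod K) mod K))"
    by (rule sum_kdelta_mod[OF assms])
  finally show ?thesis by (simp add: sum_distrib_right)
qed

section \<open>Weyl operators in the Fourier basis\<close>

definition unit_root :: "nat \<Rightarrow> complex" where
  "unit_root d = cis (2 * pi / d)"

lemma unit_root_power_self: "0 < d \<Longrightarrow> unit_root d ^ d = 1"
  by (simp add: unit_root_def DeMoivre)

lemma unit_root_power_mod:
  assumes "0 < d"
  shows "unit_root d ^ (a mod d * k) = unit_root d ^ (a * k)"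
proof -
  have "a * k = d * (a div d * k) + a mod d * k"
    by (metis add_mult_distrib mult.assoc mult_div_mod_eq)
  then show ?thesis by (simp add: power_add power_mult unit_root_power_self[OF assms])
qed

lemma cnj_unit_root_power_mult [simp]:
  "cnj (unit_root d) ^ a * unit_root d ^ a = 1" "unit_root d ^ a * cnj (unit_root d) ^ a = 1"
  by (simp_all add: power_mult_distrib[symmetric] unit_root_def cis_cnj cis_mult)

lemma unit_root_power_inj:
  assumes "j < d" "j' < d" "unit_root d ^ j = unit_root d ^ j'"
  shows "j = j'"
proof -
  have "cis (2 * pi * real k / real d) = unit_root d ^ k" for k
    by (simp add: unit_root_def DeMoivre mult_ac)
  then show ?thesis
    using bij_betw_imp_inj_on[OF bij_betw_roots_unity[of d]] assms by (auto simp: inj_on_def)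
qed

lemma unit_root_sum:
  assumes "j < d" "j' < d"
  shows "(\<Sum>m<d. cnj (unit_root d) ^ (j * m) * unit_root d ^ (j' * m)) = of_nat d * kdelta j j'"
proof (cases "j = j'")
  case False
  define z where "z = cnj (unit_root d) ^ j * unit_root d ^ j'"
  have "z \<noteq> 1"
  proof
    assume "z = 1"
    moreover have "unit_root d ^ j * z = unit_root d ^ j'" by (simp add: z_def flip: mult.assoc)
    ultimately show False using False unit_root_power_inj assms by auto
  qed
  moreover have "z ^ d = cnj (unit_root d ^ d) ^ j * (unit_root d ^ d) ^ j'"
    by (simp add: z_def power_mult_distrib mult.commute flip: power_mult)
  then have "z ^ d = 1" using assms by (simp add: unit_root_power_self)
  moreover have "(\<Sum>m<d. cnj (unit_root d) ^ (j * m) * unit_root d ^ (j' * m)) = (\<Sum>m<d. z ^ m)"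
    by (simp add: z_def power_mult_distrib power_mult)
  ultimately show ?thesis using False by (simp add: geometric_sum kdelta_def)
qed (simp add: kdelta_def)

definition fourier :: "nat \<Rightarrow> nat \<Rightarrow> cvec" where
  "fourier d j k = unit_root d ^ (j * k) / of_real (sqrt d)"

lemma fourier_orthonormal: "orthonormal d d (fourier d)"
  unfolding orthonormal_def
proof (intro allI impI)
  fix i j assume indices: "i < d" "j < d"
  have "complex_of_real (sqrt d) * complex_of_real (sqrt d) = of_nat d" by (simp flip: of_real_mult)
  then have "cinner d (fourier d i) (fourier d j)
    = (\<Sum>x<d. cnj (unit_root d) ^ (i * x) * unit_root d ^ (j * x)) / of_nat d"
    by (simp add: cinner_def fourier_def sum_divide_distrib)
  then show "cinner d (fourier d i) (fourier d j) = kdelta i j"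
    using unit_root_sum[OF indices] indices by simp
qed

lemma cmod2_fourier: "cmod2 (fourier d j k) = 1 / d"
  by (simp add: fourier_def unit_root_def norm_divide norm_power power_divide)

lemma bij_betw_add_mod:
  fixes d n :: nat
  shows "bij_betw (\<lambda>j. (j + n) mod d) {..<d} {..<d}"
proof -
  have "inj_on (\<lambda>j. (j + n) mod d) {..<d}"
  proof (rule inj_on_inverseI)
    fix j assume "j \<in> {..<d}"
    then have "j < d" "n mod d \<le> d" by (auto simp: less_imp_le)
    have "(j + n) + (d - n mod d) = j + d * Suc (n div d)"
      using mult_div_mod_eq[of d n] \<open>n mod d \<le> d\<close> unfolding mult_Suc_right by linarith
    then have "((j + n) + (d - n mod d)) mod d = (j + d * Suc (n div d)) mod d" by (rule arg_cong)
    also have "\<dots> = j" using \<open>j < d\<close> by (simp only: mod_mult_self2 mod_less)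
    finally show "((j + n) mod d + (d - n mod d)) mod d = j" by (simp only: mod_add_left_eq)
  qed
  moreover have "(\<lambda>j. (j + n) mod d) ` {..<d} \<subseteq> {..<d}" by auto
  ultimately show ?thesis unfolding bij_betw_def using endo_inj_surj[OF finite_lessThan] by blast
qed

definition cyc_sub :: "nat \<Rightarrow> nat \<Rightarrow> nat \<Rightarrow> nat" where
  "cyc_sub d j n = (j + (d - n)) mod d"

lemma cyc_sub_less: "0 < d \<Longrightarrow> cyc_sub d j n < d"
  by (simp add: cyc_sub_def)

lemma sum_cyc_sub: "(\<Sum>j<d. F (cyc_sub d j n)) = (\<Sum>j<d. F j)"
  unfolding cyc_sub_def by (rule sum.reindex_bij_betw[OF bij_betw_add_mod])

lemma weyl_entry:
  assumes "i < d" "k < d"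
  shows "weyl d m n $$ (i, k) = (if i = (k + m) mod d then unit_root d ^ (k * n) else 0)"
proof -
  have "unit_root d ^ (k * n) = exp (of_nat (k * n) * (\<i> * of_real (2 * pi / d)))"
    unfolding unit_root_def cis_conv_exp by (rule exp_of_nat_mult[symmetric])
  also have "of_nat (k * n) * (\<i> * of_real (2 * pi / d))
      = 2 * of_real pi * \<i> * of_nat k * of_nat n / (of_nat d :: complex)"
    by simp
  finally show ?thesis using assms by (simp add: weyl_def)
qed

lemma weyl_adj_fourier:
  assumes "k < d" "n < d"
  shows "(\<Sum>i<d. cnj (weyl d m n $$ (i, k)) * fourier d j i)
      = unit_root d ^ (j * m) * fourier d (cyc_sub d j n) k"
proof -
  let ?w = "unit_root d"
  have d_pos: "0 < d" using assms by simp
  have "?w ^ (cyc_sub d j n * k) * ?w ^ (k * n) = ?w ^ ((j + (d - n)) * k + k * n)"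
    by (simp add: cyc_sub_def unit_root_power_mod[OF d_pos] power_add)
  also have "(j + (d - n)) * k + k * n = (j + (d - n) + n) * k" by (simp add: add_mult_distrib)
  also have "\<dots> = d * k + j * k" using assms(2) by (simp add: add_mult_distrib)
  also have "?w ^ (d * k + j * k) = ?w ^ (j * k)"
    by (simp add: power_add power_mult unit_root_power_self[OF d_pos])
  finally have "cnj ?w ^ (k * n) * ?w ^ (j * k)
      = ?w ^ (cyc_sub d j n * k) * (?w ^ (k * n) * cnj ?w ^ (k * n))"
    by (metis mult.assoc mult.commute)
  then have phase_sub: "cnj ?w ^ (k * n) * ?w ^ (j * k) = ?w ^ (cyc_sub d j n * k)" by simp
  have "?w ^ (j * ((k + m) mod d)) = ?w ^ (j * m) * ?w ^ (j * k)"
    using unit_root_power_mod[OF d_pos, of "k + m" j] by (simp add: algebra_simps power_add)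
  then have "cnj ?w ^ (k * n) * ?w ^ (j * ((k + m) mod d))
      = ?w ^ (j * m) * (cnj ?w ^ (k * n) * ?w ^ (j * k))"
    by simp
  moreover have "(\<Sum>i<d. cnj (weyl d m n $$ (i, k)) * fourier d j i)
    = (\<Sum>i<d. if i = (k + m) mod d then cnj ?w ^ (k * n) * fourier d j i else 0)"
    by (intro sum.cong refl) (simp add: weyl_entry assms(1))
  then have "(\<Sum>i<d. cnj (weyl d m n $$ (i, k)) * fourier d j i)
      = cnj ?w ^ (k * n) * fourier d j ((k + m) mod d)"
    using d_pos by simp
  ultimately show ?thesis unfolding phase_sub by (simp add: fourier_def)
qed

section \<open>Output entropy of the Weyl channel\<close>

definition weyl_weight :: "(nat \<Rightarrow> real) \<Rightarrow> (nat \<Rightarrow> real) \<Rightarrow> nat \<Rightarrow> nat \<Rightarrow> real" where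
  "weyl_weight r p m n = (if n = 0 then r m else p n)"

definition shift_weight :: "nat \<Rightarrow> (nat \<Rightarrow> real) \<Rightarrow> (nat \<Rightarrow> real) \<Rightarrow> nat \<Rightarrow> real" where
  "shift_weight d r p m = (\<Sum>n<d. weyl_weight r p m n)"

definition weyl_conj :: "nat \<Rightarrow> nat \<Rightarrow> nat \<Rightarrow> nat \<Rightarrow> kernel \<Rightarrow> kernel" where
  "weyl_conj d K m n M = conj_kernel (d * K) (amplify K (weyl d m n)) M"

definition weyl_mixture :: "nat \<Rightarrow> nat \<Rightarrow> (nat \<Rightarrow> real) \<Rightarrow> (nat \<Rightarrow> real) \<Rightarrow> kernel \<Rightarrow> kernel" where
  "weyl_mixture d K r p M x y =
    (\<Sum>m<d. \<Sum>n<d. of_real (weyl_weight r p m n) * weyl_conj d K m n M x y)"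

definition fourier_block :: "nat \<Rightarrow> nat \<Rightarrow> kernel \<Rightarrow> nat \<Rightarrow> kernel" where
  "fourier_block d K M j a b =
    of_nat d * sesq d (\<lambda>i i'. M (i * K + a) (i' * K + b)) (fourier d j) (fourier d j)"

lemma sum_weyl_weight_mult:
  fixes F :: "nat \<Rightarrow> 'a :: real_algebra_1"
  assumes "0 < d"
  shows "(\<Sum>n<d. of_real (weyl_weight r p m n) * F n)
      = of_real (r m) * F 0 + (\<Sum>n\<in>{1..<d}. of_real (p n) * F n)"
proof -
  have "{..<d} = insert 0 {1..<d}" using assms by auto
  then show ?thesis by (simp add: weyl_weight_def)
qed

lemma shift_weight_eq: "0 < d \<Longrightarrow> shift_weight d r p m = r m + (\<Sum>n\<in>{1..<d}. p n)"
  using sum_weyl_weight_mult[of d r p m "\<lambda>_. 1 :: real"] by (simp add: shift_weight_def)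

lemma weyl_weight_nonneg:
  "\<lbrakk>\<And>m. m < d \<Longrightarrow> 0 \<le> r m; \<And>n. n \<in> {1..<d} \<Longrightarrow> 0 \<le> p n; m < d; n < d\<rbrakk> \<Longrightarrow> 0 \<le> weyl_weight r p m n"
  by (auto simp: weyl_weight_def)

lemma pos_weyl_conj: "pos_kernel (d * K) M \<Longrightarrow> pos_kernel (d * K) (weyl_conj d K m n M)"
  unfolding weyl_conj_def by (rule pos_kernel_conj)

lemma pos_weyl_mixture:
  assumes "pos_kernel (d * K) M" "\<And>m. m < d \<Longrightarrow> 0 \<le> r m" "\<And>n. n \<in> {1..<d} \<Longrightarrow> 0 \<le> p n"
  shows "pos_kernel (d * K) (weyl_mixture d K r p M)"
  unfolding weyl_mixture_def[abs_def]
  by (intro pos_kernel_sum pos_kernel_scale pos_weyl_conj assms(1))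
    (auto intro!: weyl_weight_nonneg assms(2,3))

definition weyl_block :: "nat \<Rightarrow> nat \<Rightarrow> real \<Rightarrow> (nat \<Rightarrow> real) \<Rightarrow> kernel \<Rightarrow> nat \<Rightarrow> kernel" where
  "weyl_block d K t p M j a b =
    (\<Sum>n<d. of_real (weyl_weight (\<lambda>_. t) p 0 n) * fourier_block d K M (cyc_sub d j n) a b)"

lemma sesq_weyl_conj:
  assumes "n < d"
  shows "sesq (d * K) (weyl_conj d K m n M)
      (tensor_vec K (fourier d j) g) (tensor_vec K (fourier d j') g')
    = cnj (unit_root d) ^ (j * m) * unit_root d ^ (j' * m) *
      sesq (d * K) M (tensor_vec K (fourier d (cyc_sub d j n)) g)
        (tensor_vec K (fourier d (cyc_sub d j' n)) g')"
proof -
  have "kernel_app (d * K) (kernel_adj (amplify K (weyl d m n))) (tensor_vec K (fourier d j) g) x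
      = unit_root d ^ (j * m) * tensor_vec K (fourier d (cyc_sub d j n)) g x"
    if "x < d * K" for x j g
    using that weyl_adj_fourier[OF _ assms]
    by (simp add: kernel_app_adj_amplify_tensor_vec tensor_vec_def less_mult_imp_div_less)
  then have "sesq (d * K) (weyl_conj d K m n M)
      (tensor_vec K (fourier d j) g) (tensor_vec K (fourier d j') g')
    = sesq (d * K) M (\<lambda>x. unit_root d ^ (j * m) * tensor_vec K (fourier d (cyc_sub d j n)) g x)
        (\<lambda>x. unit_root d ^ (j' * m) * tensor_vec K (fourier d (cyc_sub d j' n)) g' x)"
    unfolding weyl_conj_def sesq_conj_kernel by (intro sesq_cong) auto
  then show ?thesis by (simp add: sesq_eq sum_distrib_left mult_ac)
qed

lemma sesq_fourier_block:
  "sesq K (fourier_block d K M j) g g'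
    = of_nat d * sesq (d * K) M (tensor_vec K (fourier d j) g) (tensor_vec K (fourier d j) g')"
  unfolding sesq_tensor_vec sesq_scale[symmetric] fourier_block_def[abs_def] ..

lemma pos_fourier_block: "pos_kernel (d * K) M \<Longrightarrow> pos_kernel K (fourier_block d K M j)"
  by (simp add: pos_kernel_def sesq_fourier_block less_eq_complex_def)

lemma block_diagonal_sum_weyl_conj:
  assumes "n < d"
  shows "block_diagonal d K (fourier d) (\<lambda>x y. \<Sum>m<d. weyl_conj d K m n M x y)
    (\<lambda>j. fourier_block d K M (cyc_sub d j n))"
  unfolding block_diagonal_def sesq_sum sesq_weyl_conj[OF assms] sum_distrib_right[symmetric]
  by (auto simp: unit_root_sum sesq_fourier_block kdelta_def)

lemma ktrace_weyl_conj:
  assumes "n < d"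
  shows "ktrace (d * K) (weyl_conj d K m n M) = ktrace (d * K) M"
proof -
  let ?e = "\<lambda>j a. tensor_vec K (fourier d j) (kdelta a)"
  let ?F = "\<lambda>j. \<Sum>a<K. sesq (d * K) M (?e j a) (?e j a)"
  have basis: "orthonormal (d * K) (d * K) (\<lambda>l. ?e (l div K) (l mod K))"
    by (rule orthonormal_tensor_vec[OF fourier_orthonormal orthonormal_kdelta])
  have trace: "ktrace (d * K) N = (\<Sum>j<d. \<Sum>a<K. sesq (d * K) N (?e j a) (?e j a))" for N
    unfolding ktrace_orthonormal[OF basis, symmetric] by (rule sum_div_mod)
  have "ktrace (d * K) (weyl_conj d K m n M) = (\<Sum>j<d. ?F (cyc_sub d j n))"
    unfolding trace sesq_weyl_conj[OF assms] by simp
  also have "\<dots> = ktrace (d * K) M" unfolding trace by (rule sum_cyc_sub)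
  finally show ?thesis .
qed

lemma ktrace_weyl_mixture:
  "ktrace (d * K) (weyl_mixture d K r p M)
      = of_real (\<Sum>m<d. shift_weight d r p m) * ktrace (d * K) M"
proof -
  have "ktrace (d * K) (weyl_mixture d K r p M)
    = (\<Sum>m<d. \<Sum>n<d. of_real (weyl_weight r p m n) * ktrace (d * K) (weyl_conj d K m n M))"
    unfolding ktrace_def weyl_mixture_def sum_distrib_left by (rule sum_rotate3)
  then show ?thesis by (simp add: ktrace_weyl_conj shift_weight_def sum_distrib_right)
qed

lemma weyl_mixture_eq_mixture:
  assumes "0 < d"
  shows "weyl_mixture d K r p M = mixture d (\<lambda>m. weyl_conj d K m 0 M)
    (\<lambda>x y. \<Sum>m<d. \<Sum>n\<in>{1..<d}. of_real (p n) * weyl_conj d K m n M x y) r"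
  by (simp add: fun_eq_iff weyl_mixture_def mixture_def sum_weyl_weight_mult[OF assms] sum.distrib)

lemma block_diagonal_weyl_mixture_uniform:
  "block_diagonal d K (fourier d) (weyl_mixture d K (\<lambda>_. t) p M)
    (weyl_block d K t p M)"
proof -
  have "weyl_mixture d K (\<lambda>_. t) p M
    = (\<lambda>x y. \<Sum>n<d. of_real (weyl_weight (\<lambda>_. t) p 0 n) * (\<Sum>m<d. weyl_conj d K m n M x y))"
    unfolding weyl_mixture_def[abs_def] sum_distrib_left
    by (intro ext, subst sum.swap) (simp add: weyl_weight_def)
  then show ?thesis unfolding weyl_block_def[abs_def]
    by (simp only:) (rule block_diagonal_sum_scale, rule block_diagonal_sum_weyl_conj, simp)
qed

lemma pos_weyl_block:
  assumes "pos_kernel (d * K) M" "0 \<le> t" "\<And>n. n \<in> {1..<d} \<Longrightarrow> 0 \<le> p n"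
  shows "pos_kernel K (weyl_block d K t p M j)"
  unfolding weyl_block_def[abs_def] using assms
  by (intro pos_kernel_sum pos_kernel_scale pos_fourier_block) (auto simp: weyl_weight_def)

lemma balanced_weyl_mixture_uniform:
  assumes M_pos: "pos_kernel (d * K) M" and t_nonneg: "0 \<le> t"
    and p_nonneg: "\<And>n. n \<in> {1..<d} \<Longrightarrow> 0 \<le> p n"
  shows "\<exists>g b. balanced_eigenbasis (d * K) d (\<lambda>m. weyl_conj d K m 0 M)
    (weyl_mixture d K (\<lambda>_. t) p M) g b"
proof -
  have "\<exists>g b. eigenbasis K (weyl_block d K t p M j) g b" for j
    using pos_kernel_eigenbasis[OF pos_weyl_block[where p = p, OF M_pos t_nonneg p_nonneg]] by blast
  then obtain g b where basis: "\<And>j. eigenbasis K (weyl_block d K t p M j) (g j) (b j)" by metis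
  let ?g = "\<lambda>l. tensor_vec K (fourier d (l div K)) (g (l div K) (l mod K))"
  have "eigenbasis (d * K) (weyl_mixture d K (\<lambda>_. t) p M) ?g (\<lambda>l. b (l div K) (l mod K))"
    by (rule eigenbasis_blocks[OF fourier_orthonormal block_diagonal_weyl_mixture_uniform basis])
  moreover have "sesq (d * K) (weyl_conj d K m 0 M) (?g l) (?g l)
      = sesq (d * K) (weyl_conj d K 0 0 M) (?g l) (?g l)"
    if "m < d" for m l
    using that by (simp add: sesq_weyl_conj)
  ultimately show ?thesis unfolding balanced_eigenbasis_def by blast
qed

lemma kentropy_weyl_mixture_uniform_ge:
  assumes d_pos: "0 < d" and M_pos: "pos_kernel (d * K) M"
    and block_trace: "\<And>j. j < d \<Longrightarrow> ktrace K (fourier_block d K M j) = 1"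
    and t_nonneg: "0 \<le> t" and p_nonneg: "\<And>n. n \<in> {1..<d} \<Longrightarrow> 0 \<le> p n"
  defines "\<mu> \<equiv> shift_weight d (\<lambda>_. t) p 0"
  shows "\<mu> * (\<Sum>j<d. kentropy K (fourier_block d K M j)) - d * eta \<mu>
      \<le> kentropy (d * K) (weyl_mixture d K (\<lambda>_. t) p M)"
proof -
  let ?w = "weyl_weight (\<lambda>_. t) p 0"
  let ?S = "\<lambda>j. kentropy K (fourier_block d K M j)"
  have sum_weights: "(\<Sum>n<d. ?w n) = \<mu>" by (simp add: \<mu>_def shift_weight_def)
  have "\<mu> * (\<Sum>j<d. ?S j) - d * eta \<mu> = (\<Sum>n<d. ?w n * (\<Sum>j<d. ?S (cyc_sub d j n))) - (\<Sum>j<d. eta \<mu>)"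
    by (simp add: sum_cyc_sub[where F = ?S] sum_weights[symmetric] sum_distrib_right)
  also have "\<dots> = (\<Sum>j<d. (\<Sum>n<d. ?w n * ?S (cyc_sub d j n)) - eta \<mu>)"
    unfolding sum_distrib_left sum_subtractf by (subst sum.swap) (rule refl)
  also have "\<dots> \<le> (\<Sum>j<d. kentropy K (weyl_block d K t p M j))"
    unfolding weyl_block_def[abs_def] sum_weights[symmetric]
    by (intro sum_mono kentropy_sum_ge pos_fourier_block M_pos block_trace)
      (use t_nonneg p_nonneg d_pos in \<open>auto simp: cyc_sub_less weyl_weight_def\<close>)
  also have "\<dots> = kentropy (d * K) (weyl_mixture d K (\<lambda>_. t) p M)"
    by (rule kentropy_blocks[symmetric, OF fourier_orthonormal block_diagonal_weyl_mixture_uniform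
          pos_weyl_block[OF M_pos t_nonneg p_nonneg]])
  finally show ?thesis .
qed

locale weyl_channel =
  fixes d :: nat and r p :: "nat \<Rightarrow> real"
  assumes d_pos: "0 < d"
    and r_nonneg: "\<And>m. m < d \<Longrightarrow> 0 \<le> r m"
    and p_nonneg: "\<And>n. n \<in> {1..<d} \<Longrightarrow> 0 \<le> p n"
    and weights_total: "real d * (\<Sum>n\<in>{1..<d}. p n) + (\<Sum>m<d. r m) = 1"
begin

lemma sum_shift_weight: "(\<Sum>m<d. shift_weight d r p m) = 1"
  using weights_total by (simp add: shift_weight_eq[OF d_pos] sum.distrib)

theorem kentropy_weyl_mixture_ge:
  assumes M_pos: "pos_kernel (d * K) M"
    and block_trace: "\<And>j. j < d \<Longrightarrow> ktrace K (fourier_block d K M j) = 1"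
  shows "- (\<Sum>m<d. eta (shift_weight d r p m)) + (\<Sum>j<d. kentropy K (fourier_block d K M j)) / d
    \<le> kentropy (d * K) (weyl_mixture d K r p M)"
proof -
  define S where "S = (\<Sum>j<d. kentropy K (fourier_block d K M j))"
  have uniform: "shift_weight d r p m * S - d * eta (shift_weight d r p m)
      \<le> kentropy (d * K) (weyl_mixture d K (\<lambda>_. r m) p M)" if "m < d" for m
    using kentropy_weyl_mixture_uniform_ge[OF d_pos M_pos block_trace r_nonneg[OF that] p_nonneg]
    by (simp add: S_def shift_weight_def weyl_weight_def)
  have "- (\<Sum>m<d. eta (shift_weight d r p m)) + S / d
      = (\<Sum>m<d. shift_weight d r p m * S - d * eta (shift_weight d r p m)) / d"
    using d_pos sum_shift_weight
    by (simp add: sum_subtractf diff_divide_distrib flip: sum_distrib_left sum_distrib_right)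
  also have "\<dots> \<le> (\<Sum>m<d. kentropy (d * K) (weyl_mixture d K (\<lambda>_. r m) p M)) / d"
    by (intro divide_right_mono sum_mono uniform) auto
  also have "\<dots> \<le> kentropy (d * K) (weyl_mixture d K r p M)"
    unfolding weyl_mixture_eq_mixture[OF d_pos]
  proof (rule kentropy_mixture_ge[OF d_pos pos_weyl_conj[OF M_pos] _ _ r_nonneg])
    show "pos_kernel (d * K) (\<lambda>x y. \<Sum>m<d. \<Sum>n\<in>{1..<d}. of_real (p n) * weyl_conj d K m n M x y)"
      by (intro pos_kernel_sum pos_kernel_scale pos_weyl_conj M_pos p_nonneg)
  qed (rule balanced_weyl_mixture_uniform[OF M_pos _ p_nonneg,
        unfolded weyl_mixture_eq_mixture[OF d_pos]])
  finally show ?thesis by (simp add: S_def)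
qed

end

section \<open>Channels and decompositions\<close>

lemma H_chan_le:
  fixes N :: nat
  assumes T_density: "\<And>s. density n s \<Longrightarrow> density n (T s)"
    and decomposition: "\<And>j. j < N \<Longrightarrow> 0 \<le> \<pi> j" "\<And>j. j < N \<Longrightarrow> density n (s j)" "(\<Sum>j<N. \<pi> j) = 1"
    and \<sigma>_eq: "\<sigma> = msum n (\<lambda>j. complex_of_real (\<pi> j) \<cdot>\<^sub>m s j) {..<N}"
  shows "H_chan n T \<sigma> \<le> (\<Sum>j<N. \<pi> j * vn_entropy (T (s j)))"
  unfolding H_chan_def
proof (rule cInf_lower)
  let ?S = "{(\<Sum>j<N. \<pi> j * vn_entropy (T (s j))) | (N::nat) \<pi> s.
       (\<forall>j<N. \<pi> j \<ge> 0 \<and> density n (s j)) \<and> (\<Sum>j<N. \<pi> j) = 1 \<and>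
       \<sigma> = msum n (\<lambda>j. complex_of_real (\<pi> j) \<cdot>\<^sub>m s j) {..<N}}"
  show "(\<Sum>j<N. \<pi> j * vn_entropy (T (s j))) \<in> ?S"
    by (intro CollectI exI[of _ N] exI[of _ \<pi>] exI[of _ s]) (use decomposition \<sigma>_eq in auto)
  show "bdd_below ?S"
  proof (rule bdd_belowI)
    fix x assume "x \<in> ?S"
    then obtain N' :: nat and \<pi>' s' where "x = (\<Sum>j<N'. \<pi>' j * vn_entropy (T (s' j)))"
      "\<forall>j<N'. \<pi>' j \<ge> 0 \<and> density n (s' j)" by blast
    then show "0 \<le> x"
      using T_density by (auto intro!: sum_nonneg mult_nonneg_nonneg vn_entropy_density_nonneg)
  qed
qed

lemma munit_carrier: "munit n i j \<in> carrier_mat n n"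
  by (simp add: munit_def)

lemma munit_entry: "x < n \<Longrightarrow> y < n \<Longrightarrow> munit n i j $$ (x, y) = (if x = i \<and> y = j then 1 else 0)"
  by (simp add: munit_def)

lemma sum_munit:
  assumes "i < n" "j < n"
  shows "(\<Sum>x<n. \<Sum>y<n. F x * munit n i j $$ (x, y) * G y) = F i * G j"
proof -
  have "(\<Sum>x<n. \<Sum>y<n. F x * munit n i j $$ (x, y) * G y)
    = (\<Sum>x<n. \<Sum>y<n. if y = j then (if x = i then F i * G j else 0) else 0)"
    by (intro sum.cong refl) (auto simp: munit_entry)
  then show ?thesis using assms by simp
qed

lemma ktrace_munit:
  assumes "a < n"
  shows "ktrace n (entry (munit n a b)) = kdelta a b"
proof -
  have "ktrace n (entry (munit n a b)) = (\<Sum>x<n. if x = a then kdelta a b else 0)"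
    unfolding ktrace_def by (intro sum.cong refl) (auto simp: munit_entry kdelta_def)
  then show ?thesis using assms by simp
qed

lemma density_munit:
  assumes "k < d"
  shows "density d (munit d k k)"
proof -
  have "pos_kernel d (entry (munit d k k))"
    unfolding pos_kernel_def sesq_eq sum_munit[OF assms assms] by (simp add: less_eq_complex_def)
  then show ?thesis
    using assms by (simp add: density_iff munit_carrier ktrace_munit) (simp add: kdelta_def)
qed

lemma linear_map_on_carrier: "linear_map_on n T \<Longrightarrow> A \<in> carrier_mat n n \<Longrightarrow> T A \<in> carrier_mat n n"
  by (simp add: linear_map_on_def)

lemma linear_map_on_expand:
  assumes linear: "linear_map_on n T" and carrier: "M \<in> carrier_mat n n"
    and indices: "x < n" "y < n"
  shows "T M $$ (x, y) = (\<Sum>a<n. \<Sum>b<n. M $$ (a, b) * T (munit n a b) $$ (x, y))"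
proof -
  define R where "R S = mat n n (\<lambda>z. if z \<in> S then M $$ z else 0)" for S
  have R_carrier: "R S \<in> carrier_mat n n" for S by (simp add: R_def)
  have dim: "dim_row (T A) = n" "dim_col (T A) = n" if "A \<in> carrier_mat n n" for A
    using linear_map_on_carrier[OF linear that] by auto
  have "T (R S) $$ (x, y) = (\<Sum>(a, b)\<in>S. M $$ (a, b) * T (munit n a b) $$ (x, y))"
    if "finite S" "S \<subseteq> {..<n} \<times> {..<n}" for S
    using that
  proof (induction S)
    case empty
    have "R {} = 0 \<cdot>\<^sub>m R {}" by (intro eq_matI) (auto simp: R_def)
    then have "T (R {}) = 0 \<cdot>\<^sub>m T (R {})"
      using linear R_carrier unfolding linear_map_on_def by metis
    then have "T (R {}) $$ (x, y) = (0 \<cdot>\<^sub>m T (R {})) $$ (x, y)" by simp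
    then show ?case using dim[OF R_carrier[of "{}"]] indices by simp
  next
    case (insert z S)
    obtain a b where z: "z = (a, b)" by force
    have "R (insert z S) = M $$ (a, b) \<cdot>\<^sub>m munit n a b + R S"
      using insert.hyps insert.prems by (intro eq_matI) (auto simp: R_def munit_def z)
    then have "T (R (insert z S)) = M $$ (a, b) \<cdot>\<^sub>m T (munit n a b) + T (R S)"
      using linear R_carrier munit_carrier[of n a b] unfolding linear_map_on_def by simp
    then show ?case
      using insert dim[OF R_carrier[of S]] dim[OF munit_carrier[of n a b]] indices by (simp add: z)
  qed
  from this[of "{..<n} \<times> {..<n}"] have "T (R ({..<n} \<times> {..<n})) $$ (x, y)
    = (\<Sum>a<n. \<Sum>b<n. M $$ (a, b) * T (munit n a b) $$ (x, y))"
    by (simp add: sum.cartesian_product)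
  moreover have "R ({..<n} \<times> {..<n}) = M" using carrier by (intro eq_matI) (auto simp: R_def)
  ultimately show ?thesis by simp
qed

lemma tensor_map_carrier: "tensor_map n1 n2 A B X \<in> carrier_mat (n1 * n2) (n1 * n2)"
  by (simp add: tensor_map_def msum_def)

lemma tensor_map_entry:
  assumes A_carrier: "\<And>i j. A (munit n1 i j) \<in> carrier_mat n1 n1"
    and B_carrier: "\<And>i j. B (munit n2 i j) \<in> carrier_mat n2 n2"
    and indices: "x < n1 * n2" "y < n1 * n2"
  shows "tensor_map n1 n2 A B X $$ (x, y)
      = (\<Sum>i<n1. \<Sum>j<n1. A (munit n1 i j) $$ (x div n2, y div n2) *
    (\<Sum>a<n2. \<Sum>b<n2. X $$ (i * n2 + a, j * n2 + b) * B (munit n2 a b) $$ (x mod n2, y mod n2)))"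
proof -
  have kron: "kron (A (munit n1 i j)) (B (munit n2 a b)) $$ (x, y)
      = A (munit n1 i j) $$ (x div n2, y div n2) * B (munit n2 a b) $$ (x mod n2, y mod n2)"
    and dim: "dim_row (kron (A (munit n1 i j)) (B (munit n2 a b))) = n1 * n2"
      "dim_col (kron (A (munit n1 i j)) (B (munit n2 a b))) = n1 * n2" for i j a b
    using A_carrier[of i j] B_carrier[of a b] indices by (simp_all add: kron_def)
  have "tensor_map n1 n2 A B X $$ (x, y) = (\<Sum>i<n1. \<Sum>j<n1. \<Sum>a<n2. \<Sum>b<n2.
     (X $$ (i * n2 + a, j * n2 + b) \<cdot>\<^sub>m kron (A (munit n1 i j)) (B (munit n2 a b))) $$ (x, y))"
    using indices by (simp add: tensor_map_def msum_def sum.cartesian_product case_prod_unfold)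
  then show ?thesis using indices by (simp add: kron dim sum_distrib_left mult_ac)
qed

lemma tensor_map_id_entry:
  assumes B_carrier: "\<And>i j. B (munit n2 i j) \<in> carrier_mat n2 n2" and outer: "i < n1" "j < n1"
    and inner: "a < n2" "b < n2"
  shows "tensor_map n1 n2 (\<lambda>Y. Y) B X $$ (i * n2 + a, j * n2 + b)
    = (\<Sum>a'<n2. \<Sum>b'<n2. X $$ (i * n2 + a', j * n2 + b') * B (munit n2 a' b') $$ (a, b))"
proof -
  let ?F = "\<lambda>i j. \<Sum>a'<n2. \<Sum>b'<n2. X $$ (i * n2 + a', j * n2 + b') * B (munit n2 a' b') $$ (a, b)"
  have "tensor_map n1 n2 (\<lambda>Y. Y) B X $$ (i * n2 + a, j * n2 + b)
      = (\<Sum>k<n1. \<Sum>l<n1. munit n1 k l $$ (i, j) * ?F k l)"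
    using outer inner B_carrier
    by (subst tensor_map_entry[where A = "\<lambda>Y. Y" and B = B])
      (simp_all add: munit_carrier mult_add_less_mult)
  also have "\<dots> = (\<Sum>k<n1. \<Sum>l<n1. if l = j then (if k = i then ?F i j else 0) else 0)"
    using outer by (intro sum.cong refl) (auto simp: munit_entry)
  finally show ?thesis using outer by simp
qed

lemma density_quantum_channel:
  assumes channel: "quantum_channel n T" and density: "density n s"
  shows "density n (T s)"
proof -
  have linear: "linear_map_on n T" and cp: "completely_positive n T" and tp: "trace_preserving n T"
    and psd: "psd n s" and trace: "ctrace s = 1"
    using channel density by (auto simp: quantum_channel_def density_def)
  note T_munit = linear_map_on_carrier[OF linear munit_carrier]
  have carrier: "s \<in> carrier_mat n n" using psd by (simp add: psd_def)
  have "tensor_map 1 n (\<lambda>Y. Y) T s = T s"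
  proof (rule eq_matI)
    fix x y assume "x < dim_row (T s)" "y < dim_col (T s)"
    then have indices: "x < n" "y < n" using linear_map_on_carrier[OF linear carrier] by auto
    then show "tensor_map 1 n (\<lambda>Y. Y) T s $$ (x, y) = T s $$ (x, y)"
      using tensor_map_id_entry[of T n 0 1 0 x y s] T_munit
        linear_map_on_expand[OF linear carrier indices] by simp
  qed (use linear_map_on_carrier[OF linear carrier] tensor_map_carrier[of 1 n] in auto)
  moreover have "psd (1 * n) (tensor_map 1 n (\<lambda>Y. Y) T s)"
    by (rule cp[unfolded completely_positive_def, rule_format]) (simp_all add: psd)
  ultimately have "psd n (T s)" by (simp only: mult_1)
  moreover have "ctrace (T s) = 1" using tp carrier trace by (simp add: trace_preserving_def)
  ultimately show ?thesis by (simp add: density_def)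
qed

lemma triple_mult_mat_entry:
  assumes "A \<in> carrier_mat n n" "B \<in> carrier_mat n n" "\<sigma> \<in> carrier_mat n n" "x < n" "y < n"
  shows "(A * \<sigma> * B) $$ (x, y) = (\<Sum>i<n. \<Sum>j<n. A $$ (x, i) * \<sigma> $$ (i, j) * B $$ (j, y))"
  using assms by (simp add: scalar_prod_def atLeast0LessThan sum_distrib_left mult.assoc)

lemma Phi_carrier: "Phi d r p \<sigma> \<in> carrier_mat d d"
  by (simp add: Phi_def msum_def)

lemma Phi_entry:
  assumes d_pos: "0 < d" and \<sigma>_carrier: "\<sigma> \<in> carrier_mat d d" and indices: "x < d" "y < d"
  shows "Phi d r p \<sigma> $$ (x, y) = (\<Sum>m<d. \<Sum>n<d. of_real (weyl_weight r p m n) *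
    (\<Sum>i<d. \<Sum>j<d. weyl d m n $$ (x, i) * \<sigma> $$ (i, j) * cnj (weyl d m n $$ (y, j))))"
proof -
  define Q where
    "Q m n = (\<Sum>i<d. \<Sum>j<d. weyl d m n $$ (x, i) * \<sigma> $$ (i, j) * cnj (weyl d m n $$ (y, j)))" for m n
  have weyl_carrier: "weyl d m n \<in> carrier_mat d d" "adj (weyl d m n) \<in> carrier_mat d d" for m n
    by (simp_all add: weyl_def adj_def)
  have Q_entry: "(weyl d m n * \<sigma> * adj (weyl d m n)) $$ (x, y) = Q m n" for m n
    unfolding triple_mult_mat_entry[OF weyl_carrier \<sigma>_carrier indices] Q_def
    by (intro sum.cong refl) (use indices in \<open>simp add: adj_def weyl_def\<close>)
  have dim: "dim_row (weyl d m n * \<sigma> * adj (weyl d m n)) = d"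
    "dim_col (weyl d m n * \<sigma> * adj (weyl d m n)) = d" for m n
    by (simp_all add: adj_def weyl_def)
  have "Phi d r p \<sigma> $$ (x, y)
      = (\<Sum>m<d. of_real (r m) * Q m 0) + (\<Sum>m<d. \<Sum>n\<in>{1..<d}. of_real (p n) * Q m n)"
    using indices dim by (simp add: Phi_def msum_def Q_entry sum.cartesian_product case_prod_unfold)
  also have "\<dots> = (\<Sum>m<d. \<Sum>n<d. of_real (weyl_weight r p m n) * Q m n)"
    unfolding sum_weyl_weight_mult[OF d_pos] by (simp add: sum.distrib)
  finally show ?thesis by (simp add: Q_def)
qed

lemma Phi_eq_weyl_mixture:
  assumes "0 < d" "\<sigma> \<in> carrier_mat d d" "x < d" "y < d"
  shows "Phi d r p \<sigma> $$ (x, y) = weyl_mixture d 1 r p (entry \<sigma>) x y"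
  using assms
  by (simp add: Phi_entry weyl_mixture_def weyl_conj_def conj_amplify_eq[where K = 1, simplified])

lemma Phi_munit_entry:
  assumes "0 < d" "x < d" "y < d" "i < d" "j < d"
  shows "Phi d r p (munit d i j) $$ (x, y)
    = (\<Sum>m<d. \<Sum>n<d. of_real (weyl_weight r p m n)
        * (weyl d m n $$ (x, i) * cnj (weyl d m n $$ (y, j))))"
  unfolding Phi_entry[OF assms(1) munit_carrier assms(2,3)] sum_munit[OF assms(4,5)] ..

lemma tensor_map_Phi_entry:
  assumes d_pos: "0 < d" and linear: "linear_map_on K \<Omega>" and indices: "x < d * K" "y < d * K"
  shows "tensor_map d K (Phi d r p) \<Omega> \<rho> $$ (x, y)
    = weyl_mixture d K r p (entry (tensor_map d K (\<lambda>Y. Y) \<Omega> \<rho>)) x y"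
proof -
  define \<rho>' where "\<rho>' = tensor_map d K (\<lambda>Y. Y) \<Omega> \<rho>"
  have div_mod_less: "x div K < d" "y div K < d" "x mod K < K" "y mod K < K"
    using indices by (auto simp: less_mult_imp_div_less less_mult_imp_mod_less)
  note \<Omega>_munit = linear_map_on_carrier[OF linear munit_carrier]
  let ?W = "\<lambda>m n i. weyl d m n $$ (x div K, i)" and ?W' = "\<lambda>m n j. cnj (weyl d m n $$ (y div K, j))"
  let ?\<rho> = "\<lambda>i j. \<rho>' $$ (i * K + x mod K, j * K + y mod K)"
  let ?w = "\<lambda>m n. complex_of_real (weyl_weight r p m n)"
  have "tensor_map d K (Phi d r p) \<Omega> \<rho> $$ (x, y)
    = (\<Sum>i<d. \<Sum>j<d. Phi d r p (munit d i j) $$ (x div K, y div K) * ?\<rho> i j)"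
    using div_mod_less
    by (simp add: tensor_map_entry[where A = "Phi d r p" and B = \<Omega>, OF Phi_carrier \<Omega>_munit indices]
        \<rho>'_def tensor_map_id_entry[where B = \<Omega>, OF \<Omega>_munit])
  also have "\<dots> = (\<Sum>i<d. \<Sum>j<d. \<Sum>m<d. \<Sum>n<d. ?w m n * (?W m n i * ?\<rho> i j * ?W' m n j))"
    using d_pos div_mod_less
    by (simp add: Phi_munit_entry sum_distrib_left sum_distrib_right mult_ac)
  also have "\<dots> = (\<Sum>m<d. \<Sum>n<d. \<Sum>i<d. \<Sum>j<d. ?w m n * (?W m n i * ?\<rho> i j * ?W' m n j))"
    by (subst sum_rotate3[symmetric]) (intro sum.cong refl sum_rotate3[symmetric])
  also have "\<dots> = weyl_mixture d K r p (entry \<rho>') x y"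
    by (simp add: weyl_mixture_def weyl_conj_def conj_amplify_eq[OF indices] sum_distrib_left)
  finally show ?thesis by (simp add: \<rho>'_def)
qed

lemma vn_entropy_tensor_map_Phi:
  assumes "0 < d" "linear_map_on K \<Omega>"
  shows "vn_entropy (tensor_map d K (Phi d r p) \<Omega> \<rho>)
    = kentropy (d * K) (weyl_mixture d K r p (entry (tensor_map d K (\<lambda>Y. Y) \<Omega> \<rho>)))"
  unfolding vn_entropy_eq_kentropy[OF tensor_map_carrier]
  by (rule kentropy_cong) (rule tensor_map_Phi_entry[OF assms])

lemma (in weyl_channel) density_Phi:
  assumes "density d \<sigma>"
  shows "density d (Phi d r p \<sigma>)"
proof -
  have carrier: "\<sigma> \<in> carrier_mat d d" and pos: "pos_kernel d (entry \<sigma>)"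
    and trace: "ktrace d (entry \<sigma>) = 1"
    using assms by (auto simp: density_iff)
  note Phi = Phi_eq_weyl_mixture[OF d_pos carrier]
  have "pos_kernel (d * 1) (weyl_mixture d 1 r p (entry \<sigma>))"
    using pos r_nonneg p_nonneg by (intro pos_weyl_mixture) auto
  then have "pos_kernel d (weyl_mixture d 1 r p (entry \<sigma>))" by simp
  then have "pos_kernel d (entry (Phi d r p \<sigma>))" by (simp add: Phi cong: pos_kernel_cong)
  moreover have "ktrace d (weyl_mixture d 1 r p (entry \<sigma>)) = 1"
    using ktrace_weyl_mixture[of d 1 r p "entry \<sigma>"] trace sum_shift_weight by simp
  then have "ktrace d (entry (Phi d r p \<sigma>)) = 1" by (simp add: ktrace_def Phi)
  ultimately show ?thesis by (simp add: density_iff Phi_carrier)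
qed

lemma vn_entropy_Phi_munit:
  assumes k_less: "k < d"
  shows "vn_entropy (Phi d r p (munit d k k)) = - (\<Sum>m<d. eta (shift_weight d r p m))"
proof -
  have d_pos: "0 < d" using k_less by simp
  let ?\<mu> = "shift_weight d r p" and ?e = "\<lambda>m. kdelta ((m + k) mod d)"
  have "Phi d r p (munit d k k) $$ (x, y) = (\<Sum>m<d. of_real (?\<mu> m) * (?e m x * cnj (?e m y)))"
    if "x < d" "y < d" for x y
  proof -
    have "weyl d m n $$ (x, k) * cnj (weyl d m n $$ (y, k)) = ?e m x * cnj (?e m y)" for m n
      using that k_less by (simp add: weyl_entry kdelta_def add.commute)
    moreover have "(\<Sum>n<d. of_real (weyl_weight r p m n)) = complex_of_real (?\<mu> m)" for m
      by (simp add: shift_weight_def)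
    ultimately show ?thesis
      by (simp add: Phi_munit_entry[OF d_pos that k_less k_less]
          flip: sum_distrib_right del: of_real_sum)
  qed
  moreover have "orthonormal d d ?e"
    unfolding orthonormal_def
  proof (intro allI impI)
    fix i j assume indices: "i < d" "j < d"
    have "cinner d (?e i) (?e j) = kdelta ((i + k) mod d) ((j + k) mod d)"
      using d_pos by (intro orthonormalD[OF orthonormal_kdelta]) simp_all
    also have "\<dots> = kdelta i j"
      using inj_onD[OF bij_betw_imp_inj_on[OF bij_betw_add_mod[of k d]], of i j] indices
      by (auto simp: kdelta_def)
    finally show "cinner d (?e i) (?e j) = kdelta i j" .
  qed
  ultimately have "eigenbasis d (entry (Phi d r p (munit d k k))) ?e ?\<mu>"
    by (simp add: eigenbasis_def)
  then show ?thesis by (simp add: vn_entropy_eq_kentropy[OF Phi_carrier] kentropy_eigenbasis)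
qed

lemma ptrace_K_carrier: "ptrace_K d K \<rho> \<in> carrier_mat d d"
  by (simp add: ptrace_K_def)

lemma density_ptrace_K:
  assumes "density (d * K) \<rho>"
  shows "density d (ptrace_K d K \<rho>)"
proof -
  have pos: "pos_kernel (d * K) (entry \<rho>)" and trace: "ktrace (d * K) (entry \<rho>) = 1"
    using assms by (auto simp: density_iff)
  have "sesq d (entry (ptrace_K d K \<rho>)) f f
    = (\<Sum>a<K. sesq (d * K) (entry \<rho>) (tensor_vec K f (kdelta a)) (tensor_vec K f (kdelta a)))" for f
    by (simp add: sesq_tensor_vec sesq_kdelta_kdelta flip: sesq_sum)
      (simp add: ptrace_K_def cong: sesq_cong)
  then have "pos_kernel d (entry (ptrace_K d K \<rho>))"
    using pos by (simp add: pos_kernel_def sum_nonneg)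
  moreover have "ktrace d (entry (ptrace_K d K \<rho>)) = ktrace (d * K) (entry \<rho>)"
    unfolding ktrace_def using sum_div_mod[of "\<lambda>i a. \<rho> $$ (i * K + a, i * K + a)" K d]
    by (simp add: ptrace_K_def)
  ultimately show ?thesis using trace by (simp add: density_iff ptrace_K_carrier)
qed

lemma ptrace_K_tensor_map_id:
  assumes linear: "linear_map_on K T" and tp: "trace_preserving K T"
  shows "ptrace_K d K (tensor_map d K (\<lambda>Y. Y) T \<rho>) = ptrace_K d K \<rho>"
proof (rule eq_matI)
  fix i j assume "i < dim_row (ptrace_K d K \<rho>)" "j < dim_col (ptrace_K d K \<rho>)"
  then have indices: "i < d" "j < d" by (auto simp: ptrace_K_def)
  note T_munit = linear_map_on_carrier[OF linear munit_carrier]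
  let ?\<rho> = "\<lambda>a b. \<rho> $$ (i * K + a, j * K + b)"
  have trace_munit: "(\<Sum>c<K. T (munit K a b) $$ (c, c)) = kdelta a b" if "a < K" for a b
  proof -
    have "(\<Sum>c<K. T (munit K a b) $$ (c, c)) = ctrace (T (munit K a b))"
      using T_munit[of a b] by (simp add: ctrace_def)
    also have "\<dots> = ctrace (munit K a b)"
      using tp munit_carrier[of K a b] by (simp add: trace_preserving_def)
    also have "\<dots> = kdelta a b"
      using ktrace_munit[OF that, of b] munit_carrier[of K a b] by (simp add: ctrace_def ktrace_def)
    finally show ?thesis .
  qed
  have "ptrace_K d K (tensor_map d K (\<lambda>Y. Y) T \<rho>) $$ (i, j)
    = (\<Sum>c<K. \<Sum>a<K. \<Sum>b<K. ?\<rho> a b * T (munit K a b) $$ (c, c))"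
    using indices by (simp add: ptrace_K_def tensor_map_id_entry[where B = T, OF T_munit])
  also have "\<dots> = (\<Sum>a<K. \<Sum>b<K. ?\<rho> a b * (\<Sum>c<K. T (munit K a b) $$ (c, c)))"
    unfolding sum_distrib_left by (rule sum_rotate3)
  also have "\<dots> = (\<Sum>a<K. \<Sum>b<K. if b = a then ?\<rho> a a else 0)"
    by (intro sum.cong refl) (auto simp: trace_munit kdelta_def)
  finally show "ptrace_K d K (tensor_map d K (\<lambda>Y. Y) T \<rho>) $$ (i, j) = ptrace_K d K \<rho> $$ (i, j)"
    using indices by (simp add: ptrace_K_def)
qed (simp_all add: ptrace_K_def)

lemma sesq_fourier_diagonal:
  assumes "D \<in> carrier_mat d d" "diagonal_mat D"
  shows "sesq d (entry D) (fourier d j) (fourier d j) = ktrace d (entry D) / of_nat d"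
proof -
  have "D $$ (i, i') = 0" if "i < d" "i' < d" "i \<noteq> i'" for i i'
    using assms that by (auto simp: diagonal_mat_def)
  then have "sesq d (entry D) (fourier d j) (fourier d j)
    = (\<Sum>i<d. \<Sum>i'<d. if i' = i then D $$ (i, i) * (fourier d j i * cnj (fourier d j i)) else 0)"
    unfolding sesq_eq by (intro sum.cong refl) auto
  also have "\<dots> = (\<Sum>i<d. D $$ (i, i) * of_real (cmod2 (fourier d j i)))"
    unfolding complex_norm_square by simp
  finally show ?thesis by (simp add: cmod2_fourier ktrace_def sum_divide_distrib)
qed

lemma ktrace_fourier_block:
  assumes "diagonal_mat (ptrace_K d K \<rho>)" "density d (ptrace_K d K \<rho>)" "0 < d"
  shows "ktrace K (fourier_block d K (entry \<rho>) j) = 1"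
proof -
  have "ktrace K (fourier_block d K (entry \<rho>) j)
    = of_nat d * sesq d (entry (ptrace_K d K \<rho>)) (fourier d j) (fourier d j)"
    unfolding ktrace_def fourier_block_def sum_distrib_left[symmetric] sesq_sum[symmetric]
    by (intro arg_cong2[where f = "(*)"] refl sesq_cong) (simp_all add: ptrace_K_def)
  also have "\<dots> = ktrace d (entry (ptrace_K d K \<rho>))"
    using \<open>0 < d\<close> by (simp add: sesq_fourier_diagonal[OF ptrace_K_carrier assms(1)])
  finally show ?thesis using assms(2) by (simp add: density_iff)
qed

definition conditional_state :: "nat \<Rightarrow> nat \<Rightarrow> complex mat \<Rightarrow> nat \<Rightarrow> complex mat" where
  "conditional_state d K \<rho> j = mat K K (\<lambda>(a, b). fourier_block d K (entry \<rho>) j a b)"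

lemma density_conditional_state:
  assumes "density (d * K) \<rho>" "0 < d" "diagonal_mat (ptrace_K d K \<rho>)"
  shows "density K (conditional_state d K \<rho> j)"
proof -
  have "pos_kernel K (fourier_block d K (entry \<rho>) j)"
    using assms(1) by (simp add: density_iff pos_fourier_block)
  moreover have "ktrace K (fourier_block d K (entry \<rho>) j) = 1"
    by (rule ktrace_fourier_block[OF assms(3) density_ptrace_K[OF assms(1)] assms(2)])
  ultimately show ?thesis
    by (simp add: density_iff conditional_state_def ktrace_def cong: pos_kernel_cong)
qed

lemma ptrace_H_eq_average:
  assumes "0 < d"
  shows "ptrace_H d K \<rho> = msum K (\<lambda>j. complex_of_real (1 / d) \<cdot>\<^sub>m conditional_state d K \<rho> j) {..<d}"
    (is "_ = ?S")
proof (rule eq_matI)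
  fix a b assume "a < dim_row ?S" "b < dim_col ?S"
  then have indices: "a < K" "b < K" by (auto simp: msum_def)
  have "?S $$ (a, b)
      = (\<Sum>j<d. sesq d (\<lambda>i i'. \<rho> $$ (i * K + a, i' * K + b)) (fourier d j) (fourier d j))"
    using indices assms by (simp add: msum_def conditional_state_def fourier_block_def)
  also have "\<dots> = (\<Sum>i<d. \<rho> $$ (i * K + a, i * K + b))"
    unfolding ktrace_orthonormal[OF fourier_orthonormal] ktrace_def ..
  finally show "ptrace_H d K \<rho> $$ (a, b) = ?S $$ (a, b)" using indices by (simp add: ptrace_H_def)
qed (simp_all add: ptrace_H_def msum_def)

lemma fourier_block_tensor_map_id:
  assumes linear: "linear_map_on K T" and indices: "a < K" "b < K"
  shows "fourier_block d K (entry (tensor_map d K (\<lambda>Y. Y) T \<rho>)) j a b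
      = T (conditional_state d K \<rho> j) $$ (a, b)"
proof -
  let ?f = "fourier d j" and ?T = "\<lambda>a' b'. T (munit K a' b') $$ (a, b)"
  let ?\<rho> = "\<lambda>a' b' i i'. \<rho> $$ (i * K + a', i' * K + b')"
  have "sesq d (\<lambda>i i'. tensor_map d K (\<lambda>Y. Y) T \<rho> $$ (i * K + a, i' * K + b)) ?f ?f
    = sesq d (\<lambda>i i'. \<Sum>a'<K. \<Sum>b'<K. ?T a' b' * ?\<rho> a' b' i i') ?f ?f"
    using indices by (intro sesq_cong refl)
      (simp add: tensor_map_id_entry[where B = T, OF linear_map_on_carrier[OF linear munit_carrier]]
          mult.commute)
  also have "\<dots> = (\<Sum>a'<K. \<Sum>b'<K. ?T a' b' * sesq d (?\<rho> a' b') ?f ?f)"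
    by (simp only: sesq_sum sesq_scale)
  finally have "fourier_block d K (entry (tensor_map d K (\<lambda>Y. Y) T \<rho>)) j a b
    = (\<Sum>a'<K. \<Sum>b'<K. conditional_state d K \<rho> j $$ (a', b') * ?T a' b')"
    by (simp add: fourier_block_def conditional_state_def sum_distrib_left mult_ac)
  also have "\<dots> = T (conditional_state d K \<rho> j) $$ (a, b)"
    by (rule linear_map_on_expand[OF linear _ indices, symmetric]) (simp add: conditional_state_def)
  finally show ?thesis .
qed

lemma kentropy_fourier_block_tensor_map_id:
  assumes "linear_map_on K T"
  shows "kentropy K (fourier_block d K (entry (tensor_map d K (\<lambda>Y. Y) T \<rho>)) j)
    = vn_entropy (T (conditional_state d K \<rho> j))"
proof -
  have "T (conditional_state d K \<rho> j) \<in> carrier_mat K K"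
    by (rule linear_map_on_carrier[OF assms]) (simp add: conditional_state_def)
  from vn_entropy_eq_kentropy[OF this] show ?thesis
    by (simp add: fourier_block_tensor_map_id[OF assms] cong: kentropy_cong)
qed

lemma H_chan_ptrace_H_le:
  assumes "0 < d" "density (d * K) \<rho>" "quantum_channel K \<Omega>"
    and "diagonal_mat (ptrace_K d K \<rho>)"
  shows "H_chan K \<Omega> (ptrace_H d K \<rho>) \<le> (\<Sum>j<d. vn_entropy (\<Omega> (conditional_state d K \<rho> j))) / d"
proof -
  have "H_chan K \<Omega> (ptrace_H d K \<rho>) \<le> (\<Sum>j<d. 1 / d * vn_entropy (\<Omega> (conditional_state d K \<rho> j)))"
    by (rule H_chan_le[OF density_quantum_channel[OF assms(3)] _
          density_conditional_state[OF assms(2,1,4)] _ ptrace_H_eq_average[OF assms(1)]])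
      (use assms(1) in auto)
  then show ?thesis by (simp add: sum_divide_distrib)
qed

lemma diagonal_eq_sum_munit:
  assumes density: "density d \<sigma>" and diagonal: "diagonal_mat \<sigma>"
  shows "\<sigma> = msum d (\<lambda>k. complex_of_real (Re (\<sigma> $$ (k, k))) \<cdot>\<^sub>m munit d k k) {..<d}" (is "_ = ?S")
proof (rule eq_matI)
  fix x y assume "x < dim_row ?S" "y < dim_col ?S"
  then have indices: "x < d" "y < d" by (auto simp: msum_def)
  have diagonal_real: "\<sigma> $$ (x, x) = of_real (Re (\<sigma> $$ (x, x)))"
    using pos_kernel_diag[of d "entry \<sigma>" x] density indices
    by (simp add: density_iff less_eq_complex_def complex_eq_iff)
  have "?S $$ (x, y) = (\<Sum>k<d. (complex_of_real (Re (\<sigma> $$ (k, k))) \<cdot>\<^sub>m munit d k k) $$ (x, y))"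
    unfolding msum_def using indices by simp
  also have "\<dots> = (\<Sum>k<d. if k = x then (if x = y then of_real (Re (\<sigma> $$ (x, x))) else 0) else 0)"
    using indices by (intro sum.cong refl) (auto simp: munit_def)
  finally show "\<sigma> $$ (x, y) = ?S $$ (x, y)"
    using indices diagonal diagonal_real density by (auto simp: diagonal_mat_def density_iff)
qed (use density in \<open>auto simp: density_iff msum_def\<close>)

lemma (in weyl_channel) H_chan_Phi_diagonal_le:
  assumes density: "density d \<sigma>" and diagonal: "diagonal_mat \<sigma>"
  shows "H_chan d (Phi d r p) \<sigma> \<le> - (\<Sum>m<d. eta (shift_weight d r p m))"
proof -
  define s where "s k = Re (\<sigma> $$ (k, k))" for k
  have "(\<Sum>k<d. s k) = Re (ktrace d (entry \<sigma>))" by (simp add: s_def ktrace_def)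
  then have sum_s: "(\<Sum>k<d. s k) = 1" using density by (simp add: density_iff)
  have "H_chan d (Phi d r p) \<sigma> \<le> (\<Sum>k<d. s k * vn_entropy (Phi d r p (munit d k k)))"
  proof (rule H_chan_le[OF density_Phi])
    show "0 \<le> s k" if "k < d" for k
      using pos_kernel_diag[of d "entry \<sigma>" k] density that
      by (simp add: density_iff less_eq_complex_def s_def)
    show "\<sigma> = msum d (\<lambda>k. complex_of_real (s k) \<cdot>\<^sub>m munit d k k) {..<d}"
      unfolding s_def by (rule diagonal_eq_sum_munit[OF density diagonal])
  qed (auto simp: density_munit sum_s)
  also have "\<dots> = (\<Sum>k<d. s k) * - (\<Sum>m<d. eta (shift_weight d r p m))"
    unfolding sum_distrib_right by (intro sum.cong refl) (simp add: vn_entropy_Phi_munit)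
  finally show ?thesis by (simp add: sum_s)
qed

theorem theorem3:
  fixes d dK :: nat and r p :: "nat \<Rightarrow> real" and \<rho> :: "complex mat"
    and \<Omega> :: "complex mat \<Rightarrow> complex mat"
  assumes "prime d"
    and "0 < dK"
    and "\<forall>n \<in> {1..<d}. 0 \<le> p n \<and> p n \<le> 1"
    and "\<forall>m < d. 0 \<le> r m \<and> r m \<le> 1"
    and "real d * (\<Sum>n\<in>{1..<d}. p n) + (\<Sum>m<d. r m) = 1"
    and "density (d * dK) \<rho>"
    and "\<forall>i<d. \<forall>j<d. i \<noteq> j \<longrightarrow> ptrace_K d dK \<rho> $$ (i, j) = 0"
    and "quantum_channel dK \<Omega>"
  shows "vn_entropy (tensor_map d dK (Phi d r p) \<Omega> \<rho>)
           \<ge> H_chan d (Phi d r p) (ptrace_K d dK \<rho>) + H_chan dK \<Omega> (ptrace_H d dK \<rho>)"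
proof -
  interpret weyl_channel d r p
    using assms(1,3,4,5) by unfold_locales (auto simp: prime_gt_0_nat)
  have diagonal: "diagonal_mat (ptrace_K d dK \<rho>)"
    using assms(7) ptrace_K_carrier[of d dK \<rho>] by (auto simp: diagonal_mat_def)
  have channel: "linear_map_on dK \<Omega>" "completely_positive dK \<Omega>" "trace_preserving dK \<Omega>"
    using assms(8) by (auto simp: quantum_channel_def)
  define \<rho>' where "\<rho>' = tensor_map d dK (\<lambda>Y. Y) \<Omega> \<rho>"
  have same_marginal: "ptrace_K d dK \<rho>' = ptrace_K d dK \<rho>"
    unfolding \<rho>'_def by (rule ptrace_K_tensor_map_id[OF channel(1,3)])
  note marginal = density_ptrace_K[OF assms(6)]
  have pos: "pos_kernel (d * dK) (entry \<rho>')"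
    using channel(2) d_pos assms(6)
    unfolding completely_positive_def density_def \<rho>'_def psd_iff_pos_kernel by blast
  have "ktrace dK (fourier_block d dK (entry \<rho>') j) = 1" for j
    using ktrace_fourier_block[of d dK \<rho>'] diagonal marginal d_pos by (simp add: same_marginal)
  note kentropy_weyl_mixture_ge[OF pos this]
  moreover note vn_entropy_tensor_map_Phi[OF d_pos channel(1), of r p \<rho>, folded \<rho>'_def]
  moreover note H_chan_Phi_diagonal_le[OF marginal diagonal]
  moreover have "H_chan dK \<Omega> (ptrace_H d dK \<rho>)
      \<le> (\<Sum>j<d. kentropy dK (fourier_block d dK (entry \<rho>') j)) / d"
    using H_chan_ptrace_H_le[OF d_pos assms(6,8) diagonal]
    by (simp add: \<rho>'_def kentropy_fourier_block_tensor_map_id[OF channel(1)])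
  ultimately show ?thesis by simp
qed

end
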